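(* Let $\alpha=1/2$ and $\theta=0$. Let $S$ be a locally compact, separable metric space and $\nu_0$ a diffuse probability measure on $S$. Consider $$\mathcal{E}(F,G)=\frac12\int_{\mathcal{P}_1(S)}\langle\nabla F(\mu),\nabla G(\mu)\rangle_\mu\,\Pi_{\alpha,\theta,\nu_0}(d\mu),\qquad F,G\in\mathcal{F},$$ $$\mathcal{F}=\{F(\mu)=f(\langle\phi_1,\mu\rangle,\dots,\langle\phi_d,\mu\rangle):\ \phi_i\in B_b(S),\ 1\le i\le d,\ f\in C^\infty(\mathbb{R}^d),\ d\ge1\}.$$ Let $\{(B^k_1,\dots,B^k_{2^k})\}_{k\ge1}$ be a sequence of Borel partitions of $S$ with $\nu_0(B^k_j)=2^{-k}$ and $B^k_j=B^{k+1}_{2j-1}\cup B^{k+1}_{2j}$ for all $1\le j\le2^k$, $k\in\mathbb{N}$, and let $H(\mu)=\langle 1_{B^1_1},\mu\rangle$. Then there does not exist $LH\in L^2(\mathcal{P}_1(S);\Pi_{\alpha,\theta,\nu_0})$ such that $$\mathcal{E}(H,G)=\int_{\mathcal{P}_1(S)}-LH(\mu)\,G(\mu)\,\Pi_{\alpha,\theta,\nu_0}(d\mu)\qquad\text{for all }G\in\mathcal{F}.$$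
   Context: $\mathcal{P}_1(S)$ is the space of Borel probability measures on $S$; $B_b(S)$ is the set of bounded Borel functions on $S$; $\langle\phi,\mu\rangle=\int\phi\,d\mu$. Diffuse means $\nu_0(\{x\})=0$ for every $x\in S$. Two-parameter Dirichlet process: for $0\le\alpha<1$, $\theta>-\alpha$, let $U_k$, $k\ge1$, be independent with $U_k\sim \mathrm{Beta}(1-\alpha,\theta+k\alpha)$, and set $V_1=U_1$, $V_n=(1-U_1)\cdots(1-U_{n-1})U_n$ for $n\ge2$. Let $(P_1,P_2,\dots)$ be $(V_1,V_2,\dots)$ arranged in descending order, and let $\xi_1,\xi_2,\dots$ be i.i.d. with common law $\nu_0$, independent of $(U_k)$. Then $\Pi_{\alpha,\theta,\nu_0}$ is the law of the random probability measure $\sum_{k\ge1}P_k\delta_{\xi_k}$. Gradient: for $F(\mu)=f(\langle\phi_1,\mu\rangle,\dots,\langle\phi_d,\mu\rangle)$, $\nabla F(\mu)$ is the function $x\mapsto\nabla_xF(\mu)=\frac{d}{ds}F(\mu+s\delta_x)\big|_{s=0}=\sum_{i=1}^d\partial_if(\langle\phi_1,\mu\rangle,\dots,\langle\phi_d,\mu\rangle)\,\phi_i(x)$. For $\phi,\psi\in B_b(S)$, $\langle\phi,\psi\rangle_\mu=\int\phi\psi\,d\mu-\left(\int\phi\,d\mu\right)\left(\int\psi\,d\mu\right)$. *)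

theory Defs
  imports "HOL-Probability.Probability"
begin

definition beta_measure :: "real \<Rightarrow> real \<Rightarrow> real measure" where
  "beta_measure a b = density lborel
     (\<lambda>x. ennreal (indicator {0<..<1} x * (x powr (a - 1) * (1 - x) powr (b - 1) / Beta a b)))"

definition stick_breaking :: "(nat \<Rightarrow> real) \<Rightarrow> nat \<Rightarrow> real" where
  "stick_breaking u n = (\<Prod>i<n. 1 - u i) * u n"

text \<open>A sequence has at most one non-increasing rearrangement, and a summable sequence of positive
  numbers has exactly one.\<close>

definition descending :: "(nat \<Rightarrow> real) \<Rightarrow> nat \<Rightarrow> real" where
  "descending v = (THE p. decseq p \<and> (\<exists>\<sigma>. bij \<sigma> \<and> p = v \<circ> \<sigma>))"

definition atomic_measure :: "(nat \<Rightarrow> real) \<Rightarrow> (nat \<Rightarrow> 'a::topological_space) \<Rightarrow> 'a measure" where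
  "atomic_measure p x =
     measure_of UNIV (sets borel) (\<lambda>A. \<Sum>k. ennreal (p k) * emeasure (return borel (x k)) A)"

text \<open>The sticks are positive and add up to 1 only almost surely. On the exceptional null event the
  random measure is given the irrelevant value \<open>\<nu>0\<close>, so that it takes values in the probability
  measures everywhere.\<close>

definition random_measure ::
  "'a::topological_space measure \<Rightarrow> (nat \<Rightarrow> real) \<Rightarrow> (nat \<Rightarrow> 'a) \<Rightarrow> 'a measure" where
  "random_measure \<nu>0 u \<xi> =
     (if (\<forall>k. 0 < u k \<and> u k < 1) \<and> stick_breaking u sums 1
      then atomic_measure (descending (stick_breaking u)) \<xi> else \<nu>0)"

text \<open>Sequences are indexed from 0, so \<open>u k\<close> is the variable \<open>U\<^sub>k\<^sub>+\<^sub>1\<close>. The variables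
  \<open>U\<^sub>k\<close> and \<open>\<xi>\<^sub>k\<close> are the coordinates of a product space. The space of probability
  measures carries the \<open>\<sigma>\<close>-algebra generated by the evaluations \<open>\<mu> \<mapsto> \<mu>(A)\<close>, which for a
  separable metric space is the Borel \<open>\<sigma>\<close>-algebra of the topology of weak convergence.\<close>

definition dirichlet_process ::
  "real \<Rightarrow> real \<Rightarrow> 'a::topological_space measure \<Rightarrow> 'a measure measure" where
  "dirichlet_process \<alpha> \<theta> \<nu>0 =
     distr ((\<Pi>\<^sub>M k\<in>UNIV. beta_measure (1 - \<alpha>) (\<theta> + real (Suc k) * \<alpha>)) \<Otimes>\<^sub>M (\<Pi>\<^sub>M k\<in>(UNIV :: nat set). \<nu>0))
       (prob_algebra borel) (\<lambda>(u, \<xi>). random_measure \<nu>0 u \<xi>)"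

text \<open>The dimension \<open>d\<close> is bound inside the formulas below, so a point of \<open>\<real>\<^sup>d\<close> is a function on
  \<open>{..<d}\<close>, extended by \<open>undefined\<close>. The topology on functions is the product topology; its
  restriction to this set is the usual topology of \<open>\<real>\<^sup>d\<close>.\<close>

definition euclid :: "nat \<Rightarrow> (nat \<Rightarrow> real) set" where
  "euclid d = {..<d} \<rightarrow>\<^sub>E UNIV"

definition partial_deriv :: "nat \<Rightarrow> ((nat \<Rightarrow> real) \<Rightarrow> real) \<Rightarrow> (nat \<Rightarrow> real) \<Rightarrow> real" where
  "partial_deriv i f x = deriv (\<lambda>t. f (x(i := t))) (x i)"

primrec cont_diff :: "nat \<Rightarrow> nat \<Rightarrow> ((nat \<Rightarrow> real) \<Rightarrow> real) \<Rightarrow> bool" where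
  "cont_diff d 0 f \<longleftrightarrow> continuous_on (euclid d) f"
| "cont_diff d (Suc n) f \<longleftrightarrow> continuous_on (euclid d) f \<and>
     (\<forall>i<d. (\<forall>x\<in>euclid d. (\<lambda>t. f (x(i := t))) differentiable at (x i)) \<and>
            cont_diff d n (partial_deriv i f))"

definition smooth :: "nat \<Rightarrow> ((nat \<Rightarrow> real) \<Rightarrow> real) \<Rightarrow> bool" where
  "smooth d f \<longleftrightarrow> (\<forall>n. cont_diff d n f)"

text \<open>\<open>Cylinder d f \<phi>\<close> represents \<open>F(\<mu>) = f(\<langle>\<phi>\<^sub>0,\<mu>\<rangle>, \<dots>, \<langle>\<phi>\<^sub>d\<^sub>-\<^sub>1,\<mu>\<rangle>)\<close>. A representation is kept, rather
  than the function on probability measures alone, because \<open>\<nabla>F(\<mu>)\<close> differentiates \<open>F\<close> along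
  \<open>\<mu> + s\<delta>\<^sub>x\<close>, which is not a probability measure. Representations of the same function have
  gradients that, at each \<open>\<mu>\<close>, differ by a constant in \<open>x\<close>, which the covariance form does not see.\<close>

datatype 'a cylinder = Cylinder nat "(nat \<Rightarrow> real) \<Rightarrow> real" "nat \<Rightarrow> 'a \<Rightarrow> real"

definition cylinders :: "'a::topological_space cylinder set" where
  "cylinders = {Cylinder d f \<phi> | d f \<phi>. 1 \<le> d \<and> smooth d f \<and>
     (\<forall>i<d. \<phi> i \<in> borel_measurable borel \<and> bounded (range (\<phi> i)))}"

definition integrals :: "nat \<Rightarrow> (nat \<Rightarrow> 'a \<Rightarrow> real) \<Rightarrow> 'a measure \<Rightarrow> nat \<Rightarrow> real" where
  "integrals d \<phi> \<mu> = (\<lambda>i\<in>{..<d}. \<integral>x. \<phi> i x \<partial>\<mu>)"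

primrec cyl_fun :: "'a cylinder \<Rightarrow> 'a measure \<Rightarrow> real" where
  "cyl_fun (Cylinder d f \<phi>) \<mu> = f (integrals d \<phi> \<mu>)"

text \<open>The value of the derivative of \<open>s \<mapsto> F(\<mu> + s\<delta>\<^sub>x)\<close> at \<open>s = 0\<close>, by the chain rule.\<close>

primrec gradient :: "'a cylinder \<Rightarrow> 'a measure \<Rightarrow> 'a \<Rightarrow> real" where
  "gradient (Cylinder d f \<phi>) \<mu> x = (\<Sum>i<d. partial_deriv i f (integrals d \<phi> \<mu>) * \<phi> i x)"

definition cov_form :: "'a measure \<Rightarrow> ('a \<Rightarrow> real) \<Rightarrow> ('a \<Rightarrow> real) \<Rightarrow> real" where
  "cov_form \<mu> \<phi> \<psi> = (\<integral>x. \<phi> x * \<psi> x \<partial>\<mu>) - (\<integral>x. \<phi> x \<partial>\<mu>) * (\<integral>x. \<psi> x \<partial>\<mu>)"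

definition energy :: "'a measure measure \<Rightarrow> 'a cylinder \<Rightarrow> 'a cylinder \<Rightarrow> real" where
  "energy Q F G = 1 / 2 * (\<integral>\<mu>. cov_form \<mu> (gradient F \<mu>) (gradient G \<mu>) \<partial>Q)"

definition square_integrable :: "'b measure \<Rightarrow> ('b \<Rightarrow> real) \<Rightarrow> bool" where
  "square_integrable M g \<longleftrightarrow> g \<in> borel_measurable M \<and> integrable M (\<lambda>x. (g x)\<^sup>2)"

end

theory Submission
  imports Defs
begin

text \<open>
  Write \<open>w\<^sub>i = \<mu>(B\<^sup>k\<^sub>i)\<close> for the \<open>2m = 2\<^sup>k\<close> cell masses and \<open>A = B\<^sup>1\<^sub>1\<close>, the union of the first
  \<open>m\<close> cells. If \<open>LH\<close> existed, the Cauchy-Schwarz inequality would bound \<open>\<E>(H,G)\<close> by a constant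
  times the \<open>L\<^sup>2\<close> norm of \<open>G\<close>. The test functions
  \<open>G(\<mu>) = \<Sum>\<^sub>i\<^sub><\<^sub>m (g(w\<^sub>i) - g(w\<^sub>i\<^sub>+\<^sub>m))\<close> violate this as \<open>k\<close> grows, for a suitable function
  \<open>g\<close> of one variable.

  \<^item> The cells are exchangeable, because the atoms are placed independently and all cells have the
    same \<open>\<nu>\<^sub>0\<close>-mass. Swapping cells \<open>i\<close> and \<open>i + m\<close> changes the sign of one difference and no
    other, so the \<open>m\<close> differences are orthogonal, and the second moment of \<open>G\<close> is at most
    \<open>m\<close> times the squared oscillation of \<open>g\<close>
    (\<open>second_moment_test_function_given_sticks\<close>).

  \<^item> The energy \<open>\<E>(H,G)\<close> is half the expectation of
    \<open>(1 - \<mu>(A)) \<Sum>\<^sub>i\<^sub><\<^sub>m w\<^sub>i g'(w\<^sub>i) + \<mu>(A) \<Sum>\<^sub>i\<^sub>\<ge>\<^sub>m w\<^sub>i g'(w\<^sub>i)\<close>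
    (\<open>cov_form_half_test_cylinder\<close>). For a \<open>g\<close> that behaves like \<open>ln (w + 1/M)\<close>, the quantity
    \<open>w g'(w)\<close> is bounded below as soon as \<open>w \<ge> 1/M\<close>, while \<open>g\<close> oscillates only by about
    \<open>ln M\<close>. The Taylor polynomial \<open>log_poly M\<close> of the logarithm at 1 is such a \<open>g\<close>, and as a
    polynomial it is smooth.

  \<^item> For \<open>\<alpha> = 1/2\<close>, \<open>\<theta> = 0\<close> the first \<open>2m + 1\<close> sticks are, with probability at least one half, all
    bounded below by a constant times \<open>m\<close> to the power \<open>-5\<close>
    (\<open>stick_breaking_polynomial_lower_bound\<close>). With that many atoms available, each cell catches
    one of them with a probability bounded below (\<open>prob_cell_hit\<close>). So a polynomial \<open>M\<close> gives an
    energy of order \<open>m\<close>.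

  Altogether \<open>\<E>(H,G) \<ge> c m\<close>, whereas the norm of \<open>G\<close> is at most of order \<open>\<surd>m\<close> times \<open>ln m\<close>.
  The power law of the atoms is essential here: if they decayed exponentially, as they do for
  \<open>\<alpha> = 0\<close>, then \<open>ln M\<close> would have to be of order \<open>m\<close>.
\<close>

section \<open>Moments of the beta distribution\<close>

lemma nn_integral_Beta:
  assumes "a > 0" "b > 0"
  shows "(\<integral>\<^sup>+x. ennreal (indicator {0<..<1} x * (x powr (a - 1) * (1 - x) powr (b - 1))) \<partial>lborel)
    = ennreal (Beta a b)"
proof -
  have "(\<integral>\<^sup>+x. ennreal (indicator {0<..<1} x * (x powr (a - 1) * (1 - x) powr (b - 1))) \<partial>lborel)
    = (\<integral>\<^sup>+x. ennreal (indicator {0..1} x * (x powr (a - 1) * (1 - x) powr (b - 1))) \<partial>lborel)"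
    by (intro nn_integral_cong_AE
          eventually_mono[OF eventually_conj[OF AE_lborel_singleton[of 0] AE_lborel_singleton[of 1]]])
       (auto simp: indicator_def)
  also have "\<dots> = ennreal (Beta a b)"
    using nn_integral_has_integral_lebesgue[OF _ has_integral_Beta_real[OF assms]]
    by (simp add: mult_ac)
  finally show ?thesis .
qed

lemma Beta_real_pos: "a > 0 \<Longrightarrow> b > 0 \<Longrightarrow> Beta a b > (0 :: real)"
  by (simp add: Beta_def)

lemma
  shows space_beta_measure [simp]: "space (beta_measure a b) = UNIV"
    and sets_beta_measure [simp, measurable_cong]: "sets (beta_measure a b) = sets borel"
  by (simp_all add: beta_measure_def)

lemma AE_beta_measure: "AE x in beta_measure a b. 0 < x \<and> x < 1"
  unfolding beta_measure_def by (subst AE_density) (auto simp: indicator_def)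

text \<open>Multiplying the density by a power of \<open>1 - x\<close> only shifts the second parameter, so every
  moment of the remaining length is a quotient of two values of the Beta function.\<close>
lemma nn_integral_beta_measure_powr:
  assumes "a > 0" "b > 0" "b + c > 0"
  shows "(\<integral>\<^sup>+x. ennreal ((1 - x) powr c) \<partial>beta_measure a b) = ennreal (Beta a (b + c) / Beta a b)"
proof -
  note pos = Beta_real_pos[OF assms(1,2)] Beta_real_pos[OF assms(1,3)]
  have "(\<integral>\<^sup>+x. ennreal ((1 - x) powr c) \<partial>beta_measure a b)
    = (\<integral>\<^sup>+x. ennreal (1 / Beta a b) *
         ennreal (indicator {0<..<1} x * (x powr (a - 1) * (1 - x) powr (b + c - 1))) \<partial>lborel)"
    unfolding beta_measure_def using pos
    by (subst nn_integral_density)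
       (auto intro!: nn_integral_cong
             simp: indicator_def ennreal_mult'[symmetric] powr_add[symmetric] algebra_simps)
  also have "\<dots> = ennreal (1 / Beta a b) * ennreal (Beta a (b + c))"
    using assms by (subst nn_integral_cmult) (auto simp: nn_integral_Beta)
  also have "\<dots> = ennreal (Beta a (b + c) / Beta a b)"
    using pos by (subst ennreal_mult'[symmetric]) auto
  finally show ?thesis .
qed

lemma prob_space_beta_measure:
  assumes "a > 0" "b > 0"
  shows "prob_space (beta_measure a b)"
proof
  have "emeasure (beta_measure a b) UNIV = (\<integral>\<^sup>+x. 1 \<partial>beta_measure a b)" by simp
  also have "\<dots> = (\<integral>\<^sup>+x. ennreal ((1 - x) powr 0) \<partial>beta_measure a b)"
    using AE_beta_measure[of a b] by (intro nn_integral_cong_AE) auto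
  also have "\<dots> = 1"
    using assms Beta_real_pos[OF assms] by (subst nn_integral_beta_measure_powr) auto
  finally show "emeasure (beta_measure a b) (space (beta_measure a b)) = 1" by simp
qed

lemma nn_integral_beta_measure_remaining:
  assumes "a > 0" "b > 0"
  shows "(\<integral>\<^sup>+x. ennreal (1 - x) \<partial>beta_measure a b) = ennreal (b / (a + b))"
proof -
  have "(\<integral>\<^sup>+x. ennreal (1 - x) \<partial>beta_measure a b) = (\<integral>\<^sup>+x. ennreal ((1 - x) powr 1) \<partial>beta_measure a b)"
    using AE_beta_measure[of a b] by (intro nn_integral_cong_AE) auto
  also have "\<dots> = ennreal (Beta a (b + 1) / Beta a b)"
    using assms by (subst nn_integral_beta_measure_powr) auto
  also have "Beta a (b + 1) / Beta a b = b / (a + b)"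
    using Beta_plus1_right[of b a] assms Beta_real_pos[OF assms]
    by (simp add: field_simps nonpos_Ints_def)
  finally show ?thesis .
qed

lemma nn_integral_beta_measure_inverse_remaining:
  assumes "a > 0" "b > 1"
  shows "(\<integral>\<^sup>+x. ennreal (1 / (1 - x)) \<partial>beta_measure a b) = ennreal ((a + b - 1) / (b - 1))"
proof -
  have "(\<integral>\<^sup>+x. ennreal (1 / (1 - x)) \<partial>beta_measure a b)
      = (\<integral>\<^sup>+x. ennreal ((1 - x) powr (-1)) \<partial>beta_measure a b)"
    using AE_beta_measure[of a b]
    by (intro nn_integral_cong_AE) (auto simp: powr_minus field_simps)
  also have "\<dots> = ennreal (Beta a (b - 1) / Beta a b)"
    using assms by (subst nn_integral_beta_measure_powr) auto
  also have "Beta a (b - 1) / Beta a b = (a + b - 1) / (b - 1)"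
    using Beta_plus1_right[of "b - 1" a] assms Beta_real_pos[of a b]
    by (simp add: field_simps nonpos_Ints_def)
  finally show ?thesis .
qed

text \<open>For \<open>b \<ge> 1\<close> the density is at most \<open>x powr (a - 1) / Beta a b\<close>, and \<open>Beta a b \<ge> Beta 1 b = 1 / b\<close>.
  The resulting bound is explicit in \<open>b\<close>, as needed for a union bound over many sticks.\<close>
lemma measure_beta_measure_lessThan:
  assumes "0 < a" "a \<le> 1" "1 \<le> b" "0 < e"
  shows "measure (beta_measure a b) {..<e} \<le> b * e powr a / a"
proof -
  interpret prob_space "beta_measure a b" using assms by (intro prob_space_beta_measure) auto
  have "0 < b" using assms by simp
  then have "Gamma b \<noteq> 0" using Gamma_real_pos[of b] by linarith
  then have "Beta 1 b = 1 / b"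
    using Gamma_plus1[of b] \<open>0 < b\<close> by (simp add: Beta_def add.commute nonpos_Ints_def)
  then have B: "1 / b \<le> Beta a b" using Beta_real_mono[of a 1 b b] assms by simp
  have "emeasure (beta_measure a b) {..<e}
      = (\<integral>\<^sup>+x. ennreal (indicator {0<..<1} x * (x powr (a - 1) * (1 - x) powr (b - 1) / Beta a b))
            * indicator {..<e} x \<partial>lborel)"
    unfolding beta_measure_def by (subst emeasure_density) auto
  also have "\<dots> \<le> (\<integral>\<^sup>+x. ennreal b * ennreal (indicator {0..e} x * x powr (a - 1)) \<partial>lborel)"
  proof (intro nn_integral_mono)
    fix x :: real
    have "x powr (a - 1) * (1 - x) powr (b - 1) / Beta a b \<le> b * x powr (a - 1)" if "0 < x" "x < 1"
    proof -
      have "(1 - x) powr (b - 1) \<le> 1" using that assms by (intro powr_le1) auto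
      then have "x powr (a - 1) * (1 - x) powr (b - 1) \<le> x powr (a - 1) * (b * Beta a b)"
        using B assms by (intro mult_left_mono) (auto simp: field_simps)
      then show ?thesis
        using Beta_real_pos[of a b] assms by (simp add: field_simps)
    qed
    then show "ennreal (indicator {0<..<1} x * (x powr (a - 1) * (1 - x) powr (b - 1) / Beta a b))
            * indicator {..<e} x \<le> ennreal b * ennreal (indicator {0..e} x * x powr (a - 1))"
      using assms by (auto simp: indicator_def ennreal_mult'[symmetric] intro!: ennreal_leI)
  qed
  also have "\<dots> = ennreal b * (\<integral>\<^sup>+x. ennreal (indicator {0..e} x * x powr (a - 1)) \<partial>lborel)"
    by (rule nn_integral_cmult) auto
  also have "(\<integral>\<^sup>+x. ennreal (indicator {0..e} x * x powr (a - 1)) \<partial>lborel) = ennreal (e powr a / a)"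
    using nn_integral_has_integral_lebesgue[OF _ has_integral_powr_from_0[of "a - 1" e]] assms
    by (simp add: mult_ac)
  also have "ennreal b * ennreal (e powr a / a) = ennreal (b * e powr a / a)"
    using assms by (subst ennreal_mult'[symmetric]) auto
  finally show ?thesis
    using assms by (simp add: emeasure_eq_measure)
qed

section \<open>Decay of the sticks\<close>

lemma nn_integral_PiM_prod:
  assumes M: "\<And>i. prob_space (M i)" and "finite J" and f: "\<And>i. i \<in> J \<Longrightarrow> f i \<in> borel_measurable (M i)"
  shows "(\<integral>\<^sup>+\<omega>. (\<Prod>i\<in>J. f i (\<omega> i)) \<partial>(\<Pi>\<^sub>M i\<in>UNIV. M i)) = (\<Prod>i\<in>J. \<integral>\<^sup>+x. f i x \<partial>M i)"
proof -
  interpret M: prob_space "M i" for i by (rule M)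
  interpret product_prob_space M UNIV ..
  have "(\<Prod>i\<in>J. \<integral>\<^sup>+x. f i x \<partial>M i) = (\<integral>\<^sup>+\<omega>. (\<Prod>i\<in>J. f i (\<omega> i)) \<partial>PiM J M)"
    using \<open>finite J\<close> f by (subst product_nn_integral_prod) auto
  also have "\<dots> = (\<integral>\<^sup>+\<omega>. (\<Prod>i\<in>J. f i (\<omega> i)) \<partial>distr (PiM UNIV M) (PiM J M) (\<lambda>x. restrict x J))"
    using \<open>finite J\<close> by (subst distr_PiM_restrict_finite) auto
  also have "\<dots> = (\<integral>\<^sup>+\<omega>. (\<Prod>i\<in>J. f i (restrict \<omega> J i)) \<partial>PiM UNIV M)"
    using f by (subst nn_integral_distr) (auto intro!: measurable_restrict_subset borel_measurable_prod
      measurable_compose[OF measurable_component_singleton])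
  also have "\<dots> = (\<integral>\<^sup>+\<omega>. (\<Prod>i\<in>J. f i (\<omega> i)) \<partial>PiM UNIV M)"
    by (intro nn_integral_cong prod.cong) auto
  finally show ?thesis by simp
qed

lemma sum_stick_breaking: "(\<Sum>k<n. stick_breaking u k) = 1 - (\<Prod>i<n. 1 - u i)"
  by (induction n) (auto simp: stick_breaking_def algebra_simps)

abbreviation stick_measure :: "(nat \<Rightarrow> real) measure" where
  "stick_measure \<equiv> (\<Pi>\<^sub>M k\<in>UNIV. beta_measure (1 / 2) ((1 + real k) / 2))"

lemma prob_space_sticks: "prob_space (beta_measure (1 / 2) ((1 + real k) / 2))"
  by (rule prob_space_beta_measure) auto

interpretation sticks: product_prob_space "\<lambda>k. beta_measure (1 / 2) ((1 + real k) / 2)" UNIV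
  by (intro product_prob_spaceI prob_space_sticks)

lemma AE_sticks_unit: "AE u in stick_measure. \<forall>k. 0 < u k \<and> u k < 1"
  unfolding AE_all_countable
  by (intro allI sticks.AE_component[OF UNIV_I AE_beta_measure])

text \<open>The length left after \<open>n\<close> breaks decreases in \<open>n\<close> and has mean
  \<open>\<Prod>\<^sub>i\<^sub><\<^sub>n (i + 1) / (i + 2) = 1 / (n + 1)\<close>. Its limit therefore has mean zero.\<close>
lemma AE_sticks_sums: "AE u in stick_measure. stick_breaking u sums 1"
proof -
  define T :: "(nat \<Rightarrow> real) \<Rightarrow> nat \<Rightarrow> ennreal" where "T = (\<lambda>u n. \<Prod>i<n. ennreal (1 - u i))"
  have [measurable]: "(\<lambda>u. T u n) \<in> borel_measurable stick_measure" for n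
    unfolding T_def by measurable
  have int_T: "(\<integral>\<^sup>+u. T u n \<partial>stick_measure) = ennreal (1 / (real n + 1))" for n
  proof -
    have "(\<integral>\<^sup>+u. T u n \<partial>stick_measure) = (\<Prod>i<n. ennreal ((real i + 1) / (real i + 2)))"
      unfolding T_def
      by (subst nn_integral_PiM_prod)
         (auto simp: prob_space_sticks nn_integral_beta_measure_remaining field_simps intro!: prod.cong)
    also have "\<dots> = ennreal (\<Prod>i<n. (real i + 1) / (real i + 2))"
      by (rule prod_ennreal) auto
    also have "(\<Prod>i<n. (real i + 1) / (real i + 2)) = 1 / (real n + 1)"
      by (induction n) (auto simp: field_simps)
    finally show ?thesis .
  qed
  have "(\<integral>\<^sup>+u. (INF n. T u n) \<partial>stick_measure) \<le> ennreal (1 / (real n + 1))" for n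
    unfolding int_T[symmetric] by (intro nn_integral_mono INF_lower) auto
  moreover have "(\<lambda>n. ennreal (1 / (real n + 1))) \<longlonglongrightarrow> ennreal 0"
    using LIMSEQ_inverse_real_of_nat by (intro tendsto_ennrealI) (simp add: field_simps)
  ultimately have "(\<integral>\<^sup>+u. (INF n. T u n) \<partial>stick_measure) \<le> ennreal 0"
    by (intro LIMSEQ_le_const) auto
  then have "AE u in stick_measure. (INF n. T u n) = 0"
    by (subst nn_integral_0_iff_AE[symmetric]) auto
  with AE_sticks_unit show ?thesis
  proof eventually_elim
    case (elim u)
    have T_eq: "T u = (\<lambda>n. ennreal (\<Prod>i<n. 1 - u i))"
      unfolding T_def using elim by (auto simp: prod_ennreal less_imp_le)
    have "decseq (T u)"
      unfolding T_eq using elim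
      by (intro decseq_SucI ennreal_leI) (auto intro!: mult_left_le prod_nonneg simp: less_imp_le)
    then have "T u \<longlonglongrightarrow> 0" using LIMSEQ_INF[of "T u"] elim by simp
    then have "(\<lambda>n. \<Prod>i<n. 1 - u i) \<longlonglongrightarrow> 0"
      unfolding T_eq ennreal_0[symmetric]
      using elim by (subst (asm) tendsto_ennreal_iff) (auto intro!: always_eventually prod_nonneg simp: less_imp_le)
    from tendsto_diff[OF tendsto_const[of 1] this] show ?case
      by (simp add: sums_def sum_stick_breaking)
  qed
qed

text \<open>The inverse of \<open>1 - u\<close> has a mean only if the second beta parameter exceeds 1, which excludes
  the first two sticks. They are controlled by this qualitative statement instead.\<close>
lemma prob_near_boundary:
  assumes "prob_space M" "sets M = sets borel" "AE x in M. 0 < x \<and> x < (1 :: real)" "e > 0"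
  obtains d where "0 < d" "d < 1" "measure M {x. \<not> (d \<le> x \<and> d \<le> 1 - x)} \<le> e"
proof -
  interpret prob_space M by fact
  define A where "A = (\<lambda>n. {x. \<not> (1 / (real n + 2) \<le> x \<and> 1 / (real n + 2) \<le> 1 - x)})"
  have A: "A n \<in> events" for n
    unfolding A_def assms(2) by measurable
  have "(\<lambda>n. prob (A n)) \<longlonglongrightarrow> prob (\<Inter>n. A n)"
  proof (rule finite_Lim_measure_decseq)
    show "decseq A"
      unfolding decseq_def A_def
      by (auto simp: not_le intro: less_le_trans[OF _ divide_left_mono])
  qed (use A in auto)
  also have "prob (\<Inter>n. A n) = 0"
  proof (rule prob_eq_0[THEN iffD2])
    show "AE x in M. x \<notin> (\<Inter>n. A n)"
      using assms(3)
    proof eventually_elim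
      case (elim x)
      then obtain n where n: "inverse (real (Suc n)) < min x (1 - x)"
        using reals_Archimedean[of "min x (1 - x)"] by auto
      have "1 / (real n + 2) \<le> inverse (real (Suc n))" by (simp add: field_simps)
      with n have "x \<notin> A n" by (auto simp: A_def)
      then show ?case by auto
    qed
  qed (use A in auto)
  finally have "eventually (\<lambda>n. prob (A n) < e) sequentially"
    by (rule order_tendstoD) fact
  then obtain n where "prob (A n) < e" by (auto simp: eventually_sequentially)
  then show thesis
    by (intro that[of "1 / (real n + 2)"]) (auto simp: A_def)
qed


text \<open>Four events can spoil the bound, each of probability at most \<open>1/8\<close>: one of the first two
  breaks lies near the boundary (two events); some \<open>u k\<close> with \<open>1 \<le> k \<le> n\<close> is below a constant
  divided by \<open>(n + 1) ^ 4\<close>; or the product of the factors \<open>1 - u i\<close> with \<open>i \<ge> 2\<close> is below a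
  constant divided by \<open>n + 1\<close>. The last event is handled by Markov's inequality, because the means
  \<open>i / (i - 1)\<close> of \<open>1 / (1 - u i)\<close> telescope to \<open>n + 1\<close>.\<close>
lemma stick_breaking_polynomial_lower_bound:
  "\<exists>d>0. \<forall>n. measure stick_measure {u. \<not> (d \<le> stick_breaking u 0 \<and>
      (\<forall>k\<le>n. d / (real n + 1) ^ 5 \<le> stick_breaking u k))} \<le> 1 / 2"
proof -
  obtain e0 where e0: "0 < e0" "e0 < 1"
    "measure (beta_measure (1 / 2) ((1 + real 0) / 2)) {x. \<not> (e0 \<le> x \<and> e0 \<le> 1 - x)} \<le> 1 / 8"
    by (rule prob_near_boundary[OF prob_space_sticks[of 0] sets_beta_measure AE_beta_measure, of "1 / 8"]) auto
  obtain e1 where e1: "0 < e1" "e1 < 1"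
    "measure (beta_measure (1 / 2) ((1 + real 1) / 2)) {x. \<not> (e1 \<le> x \<and> e1 \<le> 1 - x)} \<le> 1 / 8"
    by (rule prob_near_boundary[OF prob_space_sticks[of 1] sets_beta_measure AE_beta_measure, of "1 / 8"]) auto
  define d where "d = e0 * e1 / 512"
  have "d > 0" "d \<le> e0" using e0 e1 by (auto simp: d_def field_simps)
  have marginal: "measure stick_measure {u. u i \<in> A} = measure (beta_measure (1 / 2) ((1 + real i) / 2)) A"
    if "A \<in> sets borel" for i A
    using sticks.emeasure_PiM_Collect_single[of i A] that
    by (simp add: measure_def space_PiM)
  have [measurable]: "{u. P u} \<in> sets stick_measure" if "Measurable.pred stick_measure P" for P
    using that by (simp add: pred_def space_PiM)
  have "measure stick_measure {u. \<not> (d \<le> stick_breaking u 0 \<and>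
          (\<forall>k\<le>n. d / (real n + 1) ^ 5 \<le> stick_breaking u k))} \<le> 1 / 2" for n
  proof -
    \<comment> \<open>Chosen so that the union bound below, \<open>n (n + 1) sqrt x\<close>, is at most \<open>1/8\<close>.\<close>
    define x where "x = 1 / (64 * (real n + 1) ^ 4)"
    have "x > 0" and sqrt_x: "sqrt x = 1 / (8 * (real n + 1) ^ 2)"
      by (auto simp: x_def real_sqrt_divide real_sqrt_mult intro!: real_sqrt_unique)
    \<comment> \<open>The inverse of the remaining length, without the two factors whose inverses have no mean.\<close>
    define R where "R = (\<lambda>u. \<Prod>i\<in>{2..<n+2}. ennreal (1 / (1 - u i)))"
    have [measurable]: "R \<in> borel_measurable stick_measure"
      unfolding R_def by measurable
    define bad0 where "bad0 = {u :: nat \<Rightarrow> real. u 0 \<in> {x. \<not> (e0 \<le> x \<and> e0 \<le> 1 - x)}}"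
    define bad1 where "bad1 = {u :: nat \<Rightarrow> real. u 1 \<in> {x. \<not> (e1 \<le> x \<and> e1 \<le> 1 - x)}}"
    define small where "small = (\<lambda>k. {u :: nat \<Rightarrow> real. u k \<in> {..<x}})"
    define thin where "thin = {u :: nat \<Rightarrow> real. ennreal (8 * (real n + 1)) \<le> R u}"
    have [measurable]: "bad0 \<in> sticks.events" "bad1 \<in> sticks.events" "\<And>k. small k \<in> sticks.events"
      "thin \<in> sticks.events"
      unfolding bad0_def bad1_def small_def thin_def by measurable
    have bad: "sticks.prob bad0 \<le> 1 / 8" "sticks.prob bad1 \<le> 1 / 8"
      unfolding bad0_def bad1_def using e0 e1 by (subst marginal; simp)+
    have "sticks.prob (\<Union>k\<in>{1..n}. small k) \<le> (\<Sum>k\<in>{1..n}. sticks.prob (small k))"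
      by (rule sticks.finite_measure_subadditive_finite) auto
    also have "\<dots> \<le> (\<Sum>k\<in>{1..n}. (real n + 1) * sqrt x)"
    proof (intro sum_mono)
      fix k assume k: "k \<in> {1..n}"
      have "sticks.prob (small k) \<le> (1 + real k) / 2 * x powr (1 / 2) / (1 / 2)"
        unfolding small_def using k \<open>x > 0\<close>
        by (subst marginal, simp) (rule measure_beta_measure_lessThan, auto)
      also have "\<dots> \<le> (real n + 1) * sqrt x"
        using k \<open>x > 0\<close> by (auto simp: powr_half_sqrt intro!: mult_right_mono)
      finally show "sticks.prob (small k) \<le> (real n + 1) * sqrt x" .
    qed
    also have "\<dots> \<le> 1 / 8"
      by (simp add: sqrt_x power2_eq_square divide_simps)
    finally have small: "sticks.prob (\<Union>k\<in>{1..n}. small k) \<le> 1 / 8" .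
    have "(\<integral>\<^sup>+u. R u \<partial>stick_measure) = (\<Prod>i\<in>{2..<n+2}. ennreal (real i / (real i - 1)))"
      unfolding R_def
      by (subst nn_integral_PiM_prod)
         (auto simp: prob_space_sticks nn_integral_beta_measure_inverse_remaining divide_simps
               intro!: prod.cong)
    also have "\<dots> = ennreal (\<Prod>i\<in>{2..<n+2}. real i / (real i - 1))"
      by (rule prod_ennreal) auto
    also have "(\<Prod>i\<in>{2..<n+2}. real i / (real i - 1)) = real n + 1"
      by (induction n) (auto simp: field_simps)
    finally have int_R: "(\<integral>\<^sup>+u. R u \<partial>stick_measure) = ennreal (real n + 1)" .
    have "emeasure stick_measure thin \<le> ennreal (1 / 8)"
    proof -
      have "emeasure stick_measure ({u\<in>space stick_measure. 1 \<le> ennreal (1 / (8 * (real n + 1))) * R u})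
          \<le> ennreal (1 / (8 * (real n + 1))) * (\<integral>\<^sup>+u. R u * indicator (space stick_measure) u \<partial>stick_measure)"
        by (rule nn_integral_Markov_inequality) auto
      also have "(\<integral>\<^sup>+u. R u * indicator (space stick_measure) u \<partial>stick_measure) = ennreal (real n + 1)"
        unfolding int_R[symmetric] by (intro nn_integral_cong) auto
      also have "ennreal (1 / (8 * (real n + 1))) * ennreal (real n + 1) = ennreal (1 / 8)"
        by (subst ennreal_mult'[symmetric]) auto
      also have "{u\<in>space stick_measure. 1 \<le> ennreal (1 / (8 * (real n + 1))) * R u} = thin"
      proof -
        have "1 \<le> ennreal (1 / (8 * (real n + 1))) * r \<longleftrightarrow> ennreal (8 * (real n + 1)) \<le> r" for r
        proof (cases r)
          case (real r)
          have "1 \<le> ennreal (1 / (8 * (real n + 1))) * ennreal r \<longleftrightarrow> 1 \<le> 1 / (8 * (real n + 1)) * r"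
            using real by (subst ennreal_mult'[symmetric], simp, subst ennreal_1[symmetric], subst ennreal_le_iff) auto
          also have "\<dots> \<longleftrightarrow> 8 * (real n + 1) \<le> r" by (simp add: field_simps)
          also have "\<dots> \<longleftrightarrow> ennreal (8 * (real n + 1)) \<le> ennreal r"
            using real by (intro ennreal_le_iff[symmetric])
          finally show ?thesis using real by simp
        qed (auto simp: ennreal_mult_top)
        then show ?thesis by (auto simp: thin_def space_PiM)
      qed
      finally show ?thesis .
    qed
    then have thin: "sticks.prob thin \<le> 1 / 8"
      by (simp add: sticks.emeasure_eq_measure)
    define bad where "bad = bad0 \<union> bad1 \<union> (\<Union>k\<in>{1..n}. small k) \<union> thin"
    have [measurable]: "bad \<in> sticks.events" unfolding bad_def by measurable
    have "sticks.prob bad \<le> sticks.prob bad0 + sticks.prob bad1 + sticks.prob (\<Union>k\<in>{1..n}. small k) + sticks.prob thin"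
      unfolding bad_def by (intro order_trans[OF measure_Un_le] add_mono order_refl) auto
    with bad small thin have bad: "sticks.prob bad \<le> 1 / 2" by simp
    let ?E = "{u. \<not> (d \<le> stick_breaking u 0 \<and> (\<forall>k\<le>n. d / (real n + 1) ^ 5 \<le> stick_breaking u k))}"
    have "sticks.prob ?E \<le> sticks.prob bad"
    proof (rule sticks.finite_measure_mono_AE)
      show "AE u in stick_measure. u \<in> ?E \<longrightarrow> u \<in> bad"
      proof (rule AE_mp[OF AE_sticks_unit], rule AE_I2, rule impI, rule impI, rule ccontr)
        fix u assume u: "\<forall>k. 0 < u k \<and> u k < 1" and "u \<in> ?E" "u \<notin> bad"
        have u0: "e0 \<le> u 0" "e0 \<le> 1 - u 0" and u1: "e1 \<le> 1 - u 1" and R: "R u < ennreal (8 * (real n + 1))"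
          using \<open>u \<notin> bad\<close> by (auto simp: bad_def bad0_def bad1_def thin_def)
        have uk: "x \<le> u k" if "1 \<le> k" "k \<le> n" for k
        proof -
          have "u \<notin> small k" using that \<open>u \<notin> bad\<close> by (auto simp: bad_def)
          then show ?thesis by (simp add: small_def)
        qed
        define r where "r = (\<Prod>i\<in>{2..<n+2}. 1 - u i)"
        have "r > 0" unfolding r_def using u by (intro prod_pos) auto
        have "R u = ennreal (1 / r)"
          unfolding R_def r_def using u by (subst prod_ennreal) (auto simp: prod_dividef less_imp_le)
        with R have "ennreal (1 / r) < ennreal (8 * (real n + 1))" by (simp only:)
        then have "1 / r < 8 * (real n + 1)"
          using \<open>r > 0\<close> by (subst (asm) ennreal_less_iff) auto
        then have r: "r \<ge> 1 / (8 * (real n + 1))"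
          using \<open>r > 0\<close> by (simp add: field_simps)
        have "(\<Prod>i<n + 2. 1 - u i) = (1 - u 0) * (1 - u 1) * r"
        proof -
          have "(\<Prod>i<n + 2. 1 - u i) = prod (\<lambda>i. 1 - u i) ({0, 1} \<union> {2..<n + 2})"
            by (rule arg_cong[of _ _ "prod _"]) auto
          also have "\<dots> = prod (\<lambda>i. 1 - u i) {0, 1} * prod (\<lambda>i. 1 - u i) {2..<n + 2}"
            by (rule prod.union_disjoint) auto
          finally show ?thesis by (simp add: r_def)
        qed
        also have "\<dots> \<ge> e0 * e1 * (1 / (8 * (real n + 1)))"
          using u0 u1 e0 e1 r u by (intro mult_mono) (auto simp: less_imp_le)
        finally have rest: "e0 * e1 * (1 / (8 * (real n + 1))) \<le> (\<Prod>i<n + 2. 1 - u i)" .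
        have "d \<le> stick_breaking u 0"
          using u0 \<open>d \<le> e0\<close> by (simp add: stick_breaking_def)
        moreover have "d / (real n + 1) ^ 5 \<le> stick_breaking u k" if "k \<le> n" for k
        proof (cases "k = 0")
          case True
          then show ?thesis
            using \<open>d \<le> stick_breaking u 0\<close> \<open>d > 0\<close> divide_left_mono[of 1 "(real n + 1) ^ 5" d]
            by simp
        next
          case False
          have all_pos: "0 \<le> (\<Prod>i<n + 2. 1 - u i)"
            using u by (intro prod_nonneg) (auto simp: less_imp_le)
          have "d / (real n + 1) ^ 5 = e0 * e1 * (1 / (8 * (real n + 1))) * x"
            unfolding d_def x_def by (simp add: power_Suc2[of _ 4, simplified])
          also have "\<dots> \<le> (\<Prod>i<n + 2. 1 - u i) * u k"
            using rest uk[of k] False that \<open>x > 0\<close> all_pos by (intro mult_mono) auto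
          also have "\<dots> \<le> (\<Prod>i<k. 1 - u i) * u k"
          proof (rule mult_right_mono)
            have "(\<Prod>i<n + 2. 1 - u i) = prod (\<lambda>i. 1 - u i) ({..<k} \<union> {k..<n + 2})"
              using that by (intro arg_cong[of _ _ "prod _"]) auto
            also have "\<dots> = (\<Prod>i<k. 1 - u i) * prod (\<lambda>i. 1 - u i) {k..<n + 2}"
              by (rule prod.union_disjoint) auto
            also have "\<dots> \<le> (\<Prod>i<k. 1 - u i)"
              using u by (intro mult_left_le prod_le_1 prod_nonneg) (auto simp: less_imp_le)
            finally show "(\<Prod>i<n + 2. 1 - u i) \<le> (\<Prod>i<k. 1 - u i)" .
          qed (use u less_imp_le in auto)
          finally show ?thesis by (simp add: stick_breaking_def)
        qed
        ultimately show False using \<open>u \<in> ?E\<close> by auto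
      qed
    qed auto
    with bad show ?thesis by simp
  qed
  with \<open>d > 0\<close> show ?thesis by blast
qed


section \<open>The descending rearrangement\<close>

text \<open>Order the indices by decreasing value, ties by index. Since \<open>v\<close> is positive and tends to 0, every
  index has finitely many predecessors, and counting them is a bijection onto the natural numbers.
  Its inverse is the rearrangement.\<close>
lemma exists_descending_rearrangement:
  fixes v :: "nat \<Rightarrow> real"
  assumes pos: "\<And>k. 0 < v k" and lim: "v \<longlonglongrightarrow> 0"
  obtains \<sigma> where "bij \<sigma>" "decseq (v \<circ> \<sigma>)"
proof -
  define before where "before k = {j. v k < v j \<or> (v j = v k \<and> j < k)}" for k
  define rank where "rank k = card (before k)" for k
  have fin: "finite (before k)" for k
  proof -
    obtain N where "\<And>n. n \<ge> N \<Longrightarrow> v n < v k"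
      using order_tendstoD(2)[OF lim pos[of k]] by (auto simp: eventually_sequentially)
    note N = this
    have "before k \<subseteq> {..<max N k}"
    proof
      fix j assume "j \<in> before k"
      with N[of j] show "j \<in> {..<max N k}" by (cases "N \<le> j") (auto simp: before_def)
    qed
    then show ?thesis by (rule finite_subset) auto
  qed
  have total: "j \<in> before k \<or> k \<in> before j" if "j \<noteq> k" for j k
    using that by (auto simp: before_def)
  have rank_less: "rank j < rank k" if "j \<in> before k" for j k
  proof -
    have "before j \<subset> before k" using that by (auto simp: before_def)
    then show ?thesis unfolding rank_def by (rule psubset_card_mono[OF fin])
  qed
  have "inj rank"
    by (metis injI less_irrefl rank_less total)
  have pred: "\<exists>j. rank j = m" if "rank k = Suc m" for k m
  proof -
    have ne: "before k \<noteq> {}" using that by (auto simp: rank_def)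
    have "Max (rank ` before k) \<in> rank ` before k" using fin ne by (intro Max_in) auto
    then obtain j where j: "j \<in> before k" "rank j = Max (rank ` before k)" by auto
    have "before j = before k - {j}"
    proof (intro equalityI subsetI)
      fix i assume i: "i \<in> before k - {j}"
      then have "rank i \<le> rank j" using fin by (auto simp: j(2))
      with i show "i \<in> before j" using total[of i j] rank_less[of j i] by auto
    qed (use j in \<open>auto simp: before_def\<close>)
    then have "rank j = m" using that fin j by (simp add: rank_def)
    then show ?thesis ..
  qed
  have "\<exists>j. rank j = m" for m
  proof -
    have "infinite (range rank)" using \<open>inj rank\<close> range_inj_infinite by blast
    then obtain k where "m \<le> rank k"
      by (auto simp: infinite_nat_iff_unbounded_le)
    then show ?thesis
    proof (induction "rank k - m" arbitrary: k)
      case (Suc d)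
      then obtain j where "rank j = rank k - 1" using pred[of k "rank k - 1"] by force
      with Suc show ?case by (intro Suc(1)[of j]) auto
    qed auto
  qed
  with \<open>inj rank\<close> have "bij rank" by (auto simp: bij_def surj_def) metis
  moreover have "decseq (v \<circ> inv rank)"
    unfolding decseq_def
  proof (intro allI impI, rule ccontr)
    fix a b :: nat assume "a \<le> b" and "\<not> (v \<circ> inv rank) b \<le> (v \<circ> inv rank) a"
    then have "inv rank b \<in> before (inv rank a)" by (auto simp: before_def)
    from rank_less[OF this] \<open>bij rank\<close> \<open>a \<le> b\<close> show False
      by (simp add: bij_is_surj surj_f_inv_f)
  qed
  ultimately show thesis by (intro that[of "inv rank"] bij_imp_bij_inv)
qed

text \<open>The right-hand side does not mention the rearrangement. This makes the descending sequence
  unique, and a measurable function of \<open>v\<close>.\<close>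
lemma less_descending_iff:
  fixes v :: "nat \<Rightarrow> real"
  assumes "bij \<sigma>" "decseq (v \<circ> \<sigma>)"
  shows "x < (v \<circ> \<sigma>) n \<longleftrightarrow> (\<exists>S. finite S \<and> card S = Suc n \<and> (\<forall>k\<in>S. x < v k))"
proof
  assume "x < (v \<circ> \<sigma>) n"
  then have "\<forall>k\<in>\<sigma> ` {..n}. x < v k"
    using decseqD[OF assms(2)] by (force intro: less_le_trans)
  moreover have "card (\<sigma> ` {..n}) = Suc n"
    using assms(1) by (subst card_image) (auto simp: bij_def inj_on_def)
  ultimately show "\<exists>S. finite S \<and> card S = Suc n \<and> (\<forall>k\<in>S. x < v k)"
    by (intro exI[of _ "\<sigma> ` {..n}"]) auto
next
  assume "\<exists>S. finite S \<and> card S = Suc n \<and> (\<forall>k\<in>S. x < v k)"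
  then obtain S where S: "finite S" "card S = Suc n" "\<And>k. k \<in> S \<Longrightarrow> x < v k" by auto
  have "\<not> inv \<sigma> ` S \<subseteq> {..<n}"
  proof
    assume "inv \<sigma> ` S \<subseteq> {..<n}"
    then have "card (inv \<sigma> ` S) \<le> n" using card_mono[of "{..<n}"] by auto
    moreover have "card (inv \<sigma> ` S) = card S"
      using assms(1) by (intro card_image) (metis bij_imp_bij_inv bij_is_inj inj_on_subset subset_UNIV)
    ultimately show False using S by simp
  qed
  then have "\<exists>k\<in>S. n \<le> inv \<sigma> k" by (auto simp: not_less)
  then obtain k where k: "k \<in> S" "n \<le> inv \<sigma> k" by auto
  have "x < (v \<circ> \<sigma>) (inv \<sigma> k)"
    using S(3)[OF k(1)] assms(1) by (simp add: bij_is_surj surj_f_inv_f)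
  also have "\<dots> \<le> (v \<circ> \<sigma>) n" using k decseqD[OF assms(2)] by blast
  finally show "x < (v \<circ> \<sigma>) n" .
qed

lemma descending_eq:
  fixes v :: "nat \<Rightarrow> real"
  assumes "bij \<sigma>" "decseq (v \<circ> \<sigma>)"
  shows "descending v = v \<circ> \<sigma>"
  unfolding descending_def
proof (rule the_equality)
  fix p assume "decseq p \<and> (\<exists>\<sigma>. bij \<sigma> \<and> p = v \<circ> \<sigma>)"
  then obtain \<tau> where \<tau>: "bij \<tau>" "decseq (v \<circ> \<tau>)" "p = v \<circ> \<tau>" by auto
  have "x < p n \<longleftrightarrow> x < (v \<circ> \<sigma>) n" for x n
    unfolding \<tau>(3) less_descending_iff[OF \<tau>(1,2)] less_descending_iff[OF assms] ..
  then show "p = v \<circ> \<sigma>" by (intro ext) (metis linorder_neqE less_irrefl)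
qed (use assms in auto)

text \<open>The almost sure event on which the random measure is built from the sticks.\<close>
definition valid_sticks :: "(nat \<Rightarrow> real) \<Rightarrow> bool" where
  "valid_sticks u \<longleftrightarrow> (\<forall>k. 0 < u k \<and> u k < 1) \<and> stick_breaking u sums 1"

lemma valid_sticks_descending:
  assumes "valid_sticks u"
  obtains \<sigma> where "bij \<sigma>" "decseq (stick_breaking u \<circ> \<sigma>)" "descending (stick_breaking u) = stick_breaking u \<circ> \<sigma>"
    "\<And>k. 0 < stick_breaking u k"
proof -
  have pos: "0 < stick_breaking u k" for k
    using assms unfolding valid_sticks_def stick_breaking_def by (auto intro!: prod_pos mult_pos_pos)
  have "stick_breaking u \<longlonglongrightarrow> 0"
    using assms unfolding valid_sticks_def by (auto intro: summable_LIMSEQ_zero sums_summable)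
  from exists_descending_rearrangement[OF pos this] obtain \<sigma> where \<sigma>: "bij \<sigma>" "decseq (stick_breaking u \<circ> \<sigma>)"
    by blast
  from that[OF \<sigma> descending_eq[OF \<sigma>] pos] show thesis .
qed

lemma less_descending_sticks_iff:
  assumes "valid_sticks u"
  shows "x < descending (stick_breaking u) n
    \<longleftrightarrow> (\<exists>S. finite S \<and> card S = Suc n \<and> (\<forall>k\<in>S. x < stick_breaking u k))"
proof -
  from assms obtain \<sigma> where \<sigma>: "bij \<sigma>" "decseq (stick_breaking u \<circ> \<sigma>)"
    "descending (stick_breaking u) = stick_breaking u \<circ> \<sigma>"
    by (rule valid_sticks_descending)
  show ?thesis unfolding \<sigma>(3) by (rule less_descending_iff[OF \<sigma>(1,2)])
qed

lemma suminf_descending_sticks: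
  assumes "valid_sticks u"
  shows "(\<Sum>k. ennreal (descending (stick_breaking u) k)) = 1"
proof -
  from assms obtain \<sigma> where \<sigma>: "bij \<sigma>" "descending (stick_breaking u) = stick_breaking u \<circ> \<sigma>"
    "\<And>k. 0 < stick_breaking u k"
    using valid_sticks_descending by metis
  have "(\<Sum>k. ennreal (descending (stick_breaking u) k))
      = (\<integral>\<^sup>+k. ennreal (stick_breaking u (\<sigma> k)) \<partial>count_space UNIV)"
    by (simp add: \<sigma> nn_integral_count_space_nat)
  also have "\<dots> = (\<Sum>k. ennreal (stick_breaking u k))"
    using \<sigma>(1) by (subst nn_integral_bij_count_space) (auto simp: nn_integral_count_space_nat)
  also have "\<dots> = ennreal 1"
    using assms \<sigma>(3) unfolding valid_sticks_def
    by (intro suminf_ennreal_eq) (auto simp: less_imp_le)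
  finally show ?thesis by simp
qed

lemma descending_sticks_lower_bound:
  assumes "valid_sticks u" "\<And>k. k \<le> n \<Longrightarrow> c \<le> stick_breaking u k" "k \<le> n"
  shows "c \<le> descending (stick_breaking u) k"
proof (rule ccontr)
  assume "\<not> ?thesis"
  then have less: "descending (stick_breaking u) k < c" by simp
  have "descending (stick_breaking u) k < stick_breaking u j" if "j \<in> {..k}" for j
    using less_le_trans[OF less assms(2)[of j]] that \<open>k \<le> n\<close> by simp
  then have "\<exists>S. finite S \<and> card S = Suc k \<and> (\<forall>j\<in>S. descending (stick_breaking u) k < stick_breaking u j)"
    by (intro exI[of _ "{..k}"]) simp
  then show False unfolding less_descending_sticks_iff[OF assms(1), symmetric] by simp
qed

section \<open>The random measure\<close>
lemma atomic_measure_eq_distr: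
  "atomic_measure p x = distr (density (count_space UNIV) (\<lambda>k. ennreal (p k))) borel x"
proof -
  let ?M = "distr (density (count_space UNIV) (\<lambda>k. ennreal (p k))) borel x"
  have emeasure_distr_eq: "emeasure ?M A = (\<Sum>k. ennreal (p k) * emeasure (return borel (x k)) A)" if "A \<in> sets borel" for A
    using that
    by (subst emeasure_distr, simp, simp, subst emeasure_density)
       (auto simp: nn_integral_count_space_nat indicator_def intro!: suminf_cong)
  have "atomic_measure p x = measure_of UNIV (sets borel) (emeasure ?M)"
    unfolding atomic_measure_def
  proof (rule measure_of_eq)
    fix A :: "'a set" assume "A \<in> sigma_sets UNIV (sets borel)"
    then have "A \<in> sets borel" using sets.sigma_sets_eq[of "borel :: 'a measure"] by simp
    then show "(\<Sum>k. ennreal (p k) * emeasure (return borel (x k)) A) = emeasure ?M A"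
      by (rule emeasure_distr_eq[symmetric])
  qed simp
  also have "\<dots> = ?M" using measure_of_of_measure[of ?M] by simp
  finally show ?thesis .
qed

lemma
  shows sets_atomic_measure [simp]: "sets (atomic_measure p x) = sets borel"
    and space_atomic_measure [simp]: "space (atomic_measure p x) = UNIV"
  by (simp_all add: atomic_measure_eq_distr)

lemma emeasure_atomic_measure:
  assumes "A \<in> sets borel"
  shows "emeasure (atomic_measure p x) A = (\<Sum>k. ennreal (p k) * indicator A (x k))"
  using assms unfolding atomic_measure_eq_distr
  by (subst emeasure_distr, simp, simp, subst emeasure_density)
     (auto simp: nn_integral_count_space_nat indicator_def intro!: suminf_cong)

lemma random_measure_valid:
  "valid_sticks u \<Longrightarrow> random_measure \<nu> u \<xi> = atomic_measure (descending (stick_breaking u)) \<xi>"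
  "\<not> valid_sticks u \<Longrightarrow> random_measure \<nu> u \<xi> = \<nu>"
  unfolding random_measure_def valid_sticks_def by (rule if_P if_not_P, assumption)+

lemma prob_space_random_measure:
  assumes "prob_space \<nu>"
  shows "prob_space (random_measure \<nu> u \<xi>)"
proof (cases "valid_sticks u")
  case True
  then show ?thesis
    by (intro prob_spaceI)
       (simp add: random_measure_valid emeasure_atomic_measure suminf_descending_sticks)
qed (use assms in \<open>simp add: random_measure_valid\<close>)

lemma measurable_stick_breaking [measurable]:
  "(\<lambda>u. stick_breaking u k) \<in> borel_measurable stick_measure"
  unfolding stick_breaking_def by measurable

lemma pred_valid_sticks [measurable]: "Measurable.pred stick_measure valid_sticks"
  unfolding valid_sticks_def sums_def by measurable


text \<open>Off the valid event the value 0 stands in for the unspecified value of \<open>descending\<close>, which makes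
  the weight measurable on the whole space.\<close>
definition atom_weight :: "(nat \<Rightarrow> real) \<Rightarrow> nat \<Rightarrow> real" where
  "atom_weight u k = (if valid_sticks u then descending (stick_breaking u) k else 0)"

text \<open>The finite index sets in the description of the descending sequence are enumerated by lists
  without repetition, of which there are only countably many.\<close>
lemma measurable_atom_weight [measurable]:
  "(\<lambda>u. atom_weight u n) \<in> borel_measurable stick_measure"
proof (rule borel_measurableI_greater)
  fix x :: real
  have lists: "(\<exists>S. finite S \<and> card S = Suc n \<and> (\<forall>k\<in>S. x < v k)) \<longleftrightarrow>
    (\<exists>ks. (length ks = Suc n \<and> distinct ks) \<and> (\<forall>k\<in>set ks. x < v k))" for v :: "nat \<Rightarrow> real"
    by (metis List.finite_set distinct_card finite_distinct_list)
  have "{u \<in> space stick_measure. x < atom_weight u n}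
    = {u \<in> space stick_measure. if valid_sticks u
         then \<exists>ks. (length ks = Suc n \<and> distinct ks) \<and> (\<forall>k\<in>set ks. x < stick_breaking u k) else x < 0}"
    by (auto simp: atom_weight_def less_descending_sticks_iff lists)
  also have "\<dots> \<in> sets stick_measure" by measurable
  finally show "{u \<in> space stick_measure. x < atom_weight u n} \<in> sets stick_measure" .
qed

text \<open>The Dirichlet process is the image of the product measure under this map, and integrals against
  it can be pulled back to sticks and labels only because the map is measurable.\<close>
lemma measurable_random_measure:
  fixes \<nu> :: "'a::topological_space measure"
  assumes "prob_space \<nu>" and sets: "sets \<nu> = sets borel"
  shows "(\<lambda>(u, \<xi>). random_measure \<nu> u \<xi>)
    \<in> stick_measure \<Otimes>\<^sub>M (\<Pi>\<^sub>M k\<in>(UNIV :: nat set). \<nu>) \<rightarrow>\<^sub>M prob_algebra borel"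
proof (intro measurable_prob_algebraI measurable_subprob_algebra)
  let ?M = "stick_measure \<Otimes>\<^sub>M (\<Pi>\<^sub>M k\<in>(UNIV :: nat set). \<nu>)"
  show "prob_space (case w of (u, \<xi>) \<Rightarrow> random_measure \<nu> u \<xi>)" for w
    using assms(1) by (cases w) (simp add: prob_space_random_measure)
  then show "subprob_space (case w of (u, \<xi>) \<Rightarrow> random_measure \<nu> u \<xi>)" for w
    by (rule prob_space_imp_subprob_space)
  show "Sigma_Algebra.sets (case w of (u, \<xi>) \<Rightarrow> random_measure \<nu> u \<xi>) = Sigma_Algebra.sets borel" for w
    using sets by (cases w) (simp add: random_measure_def)
  fix A :: "'a set" assume A [measurable]: "A \<in> Sigma_Algebra.sets borel"
  note sets[measurable_cong]
  have "(\<lambda>w. emeasure (case w of (u, \<xi>) \<Rightarrow> random_measure \<nu> u \<xi>) A)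
    = (\<lambda>w. if valid_sticks (fst w)
         then \<Sum>k. ennreal (atom_weight (fst w) k) * indicator A (snd w k)
         else emeasure \<nu> A)"
    by (auto simp: fun_eq_iff random_measure_valid emeasure_atomic_measure atom_weight_def)
  also have "\<dots> \<in> borel_measurable ?M"
  proof -
    have [measurable]: "Measurable.pred ?M (\<lambda>w. valid_sticks (fst w))"
      by (rule measurable_compose[OF measurable_fst pred_valid_sticks])
    have [measurable]: "(\<lambda>w. atom_weight (fst w) k) \<in> borel_measurable ?M" for k
      by (rule measurable_compose[OF measurable_fst measurable_atom_weight])
    have "(\<lambda>w. snd w k) \<in> ?M \<rightarrow>\<^sub>M \<nu>" for k
      by (rule measurable_compose[OF measurable_snd measurable_component_singleton]) simp
    then have [measurable]: "(\<lambda>w. snd w k) \<in> ?M \<rightarrow>\<^sub>M borel" for k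
      by (simp cong: measurable_cong_sets)
    have "(\<lambda>w. ennreal (atom_weight (fst w) k) * indicator A (snd w k)) \<in> borel_measurable ?M" for k
      by measurable
    then have "(\<lambda>w. \<Sum>k. ennreal (atom_weight (fst w) k) * indicator A (snd w k)) \<in> borel_measurable ?M"
      by (rule borel_measurable_suminf_order)
    then show ?thesis by (intro measurable_If) auto
  qed
  finally show "(\<lambda>w. emeasure (case w of (u, \<xi>) \<Rightarrow> random_measure \<nu> u \<xi>) A) \<in> borel_measurable ?M" .
qed


section \<open>Polynomial substitutes for the logarithm\<close>

text \<open>The Taylor polynomial of degree \<open>n\<close> of \<open>ln\<close> at 1.\<close>
primrec log_poly :: "nat \<Rightarrow> real poly" where
  "log_poly 0 = 0"
| "log_poly (Suc n) = log_poly n - smult (1 / real (Suc n)) ([:1, -1:] ^ Suc n)"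

text \<open>The derivative is the geometric sum \<open>\<Sum>\<^sub>l\<^sub><\<^sub>n (1 - x)\<^sup>l\<close>. For \<open>0 \<le> x \<le> 1\<close> its product
  with \<open>x\<close> lies between 0 and 1, and it is at least \<open>1/2\<close> once \<open>x \<ge> 1 / n\<close>.\<close>
lemma log_poly_derivative: "x * poly (pderiv (log_poly n)) x = 1 - (1 - x) ^ n"
proof (induction n)
  case (Suc n)
  have "poly (pderiv (log_poly (Suc n))) x = poly (pderiv (log_poly n)) x + (1 - x) ^ n"
    by (simp add: pderiv_diff pderiv_smult pderiv_power_Suc pderiv_pCons poly_power del: power_Suc of_nat_Suc)
  with Suc show ?case by (simp add: algebra_simps)
qed simp

lemma poly_log_poly: "poly (log_poly n) x = - (\<Sum>l<n. (1 - x) ^ Suc l / real (Suc l))"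
  by (induction n) (simp_all add: poly_power del: power_Suc)

text \<open>On the unit interval the modulus is at most the harmonic number, of which each dyadic block of
  terms contributes at most 1. The degree is a power of two so that this logarithmic bound
  is just the exponent.\<close>
lemma log_poly_bounds:
  assumes "0 \<le> x" "x \<le> 1"
  shows "poly (log_poly (2 ^ r)) x \<in> {- (1 + real r)..0}"
proof -
  have "(\<Sum>l<2 ^ r. 1 / real (Suc l)) \<le> 1 + real r"
  proof (induction r)
    case (Suc r)
    have "(\<Sum>l<2 ^ Suc r. 1 / real (Suc l))
        = (\<Sum>l<2 ^ r. 1 / real (Suc l)) + (\<Sum>l = 2 ^ r..<2 ^ Suc r. 1 / real (Suc l))"
      by (simp add: lessThan_atLeast0 sum.atLeastLessThan_concat)
    also have "(\<Sum>l = 2 ^ r..<2 ^ Suc r. 1 / real (Suc l)) \<le> (\<Sum>l = 2 ^ r..<(2 ^ Suc r :: nat). 1 / 2 ^ r)"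
    proof (rule sum_mono)
      fix l :: nat assume "l \<in> {2 ^ r..<2 ^ Suc r}"
      then have "real (2 ^ r) \<le> real (Suc l)" by (intro of_nat_mono) simp
      then show "1 / real (Suc l) \<le> 1 / 2 ^ r" by (intro divide_left_mono) simp_all
    qed
    also have "\<dots> = 1" by simp
    finally show ?case using Suc by simp
  qed simp
  moreover have "(\<Sum>l<2 ^ r. (1 - x) ^ Suc l / real (Suc l)) \<le> (\<Sum>l<2 ^ r. 1 / real (Suc l))"
    using assms by (intro sum_mono divide_right_mono power_le_one) auto
  moreover have "0 \<le> (\<Sum>l<2 ^ r. (1 - x) ^ Suc l / real (Suc l))"
    using assms by (intro sum_nonneg divide_nonneg_nonneg zero_le_power) auto
  ultimately show ?thesis by (simp add: poly_log_poly)
qed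

lemma DERIV_separated_sum:
  fixes i d :: nat
  assumes "i < d"
  shows "((\<lambda>t. \<Sum>j<d. poly (q j) ((x(i := t)) j)) has_field_derivative poly (pderiv (q i)) t) (at t)"
proof -
  have "((\<lambda>t. \<Sum>j<d. poly (q j) ((x(i := t)) j)) has_field_derivative
      (\<Sum>j<d. if j = i then poly (pderiv (q i)) t else 0)) (at t)"
  proof (rule DERIV_sum)
    fix j show "((\<lambda>t. poly (q j) ((x(i := t)) j)) has_field_derivative
        (if j = i then poly (pderiv (q i)) t else 0)) (at t)"
      by (cases "j = i") (auto simp: poly_DERIV)
  qed
  also have "(\<Sum>j<d. if j = i then poly (pderiv (q i)) t else 0) = poly (pderiv (q i)) t"
    using assms by simp
  finally show ?thesis .
qed

lemma partial_deriv_separated_sum: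
  assumes "i < d"
  shows "partial_deriv i (\<lambda>x. \<Sum>j<d. poly (q j) (x j)) = (\<lambda>x. poly (pderiv (q i)) (x i))"
  unfolding partial_deriv_def fun_eq_iff
  by (intro allI DERIV_imp_deriv DERIV_separated_sum assms)

text \<open>Sums of polynomials in single coordinates are closed under partial derivatives, which gives the
  induction over the order of differentiation.\<close>
lemma smooth_separated_sum: "smooth d (\<lambda>x. \<Sum>j<d. poly (q j) (x j))"
proof -
  have cont: "continuous_on (euclid d) (\<lambda>x. \<Sum>j<d. poly (q j) (x j))" for q :: "nat \<Rightarrow> real poly"
    by (intro continuous_intros continuous_on_subset[OF continuous_on_product_coordinates]) auto
  have "cont_diff d n (\<lambda>x. \<Sum>j<d. poly (q j) (x j))" for n
  proof (induction n arbitrary: q)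
    case (Suc n)
    have "cont_diff d n (partial_deriv i (\<lambda>x. \<Sum>j<d. poly (q j) (x j)))" if "i < d" for i
    proof -
      have "partial_deriv i (\<lambda>x. \<Sum>j<d. poly (q j) (x j))
          = (\<lambda>x. \<Sum>j<d. poly (if j = i then pderiv (q i) else 0) (x j))"
        using that by (simp add: partial_deriv_separated_sum fun_eq_iff if_distrib[of "\<lambda>p. poly p _"] cong: if_cong)
      with Suc.IH show ?thesis by simp
    qed
    moreover have "(\<lambda>t. \<Sum>j<d. poly (q j) ((x(i := t)) j)) differentiable at (x i)" if "i < d" for x i
      using DERIV_separated_sum[OF that] real_differentiable_def by blast
    ultimately show ?case using cont by simp
  qed (simp add: cont)
  then show ?thesis by (simp add: smooth_def)
qed

section \<open>Test functions on a halved partition\<close>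

text \<open>One level of the sequence of partitions, with cells numbered from 0. Cell \<open>i\<close> of the half
  \<open>A\<close> is paired with cell \<open>i + m\<close> of its complement.\<close>
locale halved_partition = prob_space \<nu> for \<nu> :: "'a::topological_space measure" +
  fixes C :: "nat \<Rightarrow> 'a set" and m :: nat and A :: "'a set"
  assumes sets_base: "sets \<nu> = sets borel"
    and m_pos: "0 < m"
    and cells: "\<And>i. i < 2 * m \<Longrightarrow> C i \<in> sets borel"
    and disjoint: "disjoint_family_on C {..<2 * m}"
    and cover: "(\<Union>i<2 * m. C i) = UNIV"
    and prob_cell: "\<And>i. i < 2 * m \<Longrightarrow> measure \<nu> (C i) = 1 / real (2 * m)"
    and half: "A = (\<Union>i<m. C i)"
begin

definition half_sign :: "nat \<Rightarrow> real" where
  "half_sign i = (if i < m then 1 else -1)"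

definition test_cylinder :: "real poly \<Rightarrow> 'a cylinder" where
  "test_cylinder g = Cylinder (2 * m) (\<lambda>x. \<Sum>i<2 * m. poly (smult (half_sign i) g) (x i)) (\<lambda>i. indicator (C i))"

lemma half_borel [measurable]: "A \<in> sets borel"
  using cells m_pos unfolding half by (intro sets.finite_UN) auto

lemma test_cylinder_in_cylinders: "test_cylinder g \<in> cylinders"
proof -
  have "bounded (range (indicator S :: 'a \<Rightarrow> real))" for S
    by (rule boundedI[of _ 1]) (auto simp: indicator_def)
  then show ?thesis
    unfolding cylinders_def test_cylinder_def using m_pos cells
      smooth_separated_sum[of "2 * m" "\<lambda>i. smult (half_sign i) g"] by auto
qed

lemma indicator_half: "indicator A x = (\<Sum>i<m. indicator (C i) x :: real)"
  unfolding half
  by (rule indicator_UN_disjoint) (auto intro: disjoint_family_on_mono[OF _ disjoint])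

lemma indicator_cell_mult:
  assumes "i < 2 * m" "j < 2 * m"
  shows "indicator (C i) x * indicator (C j) x = (if i = j then indicator (C i) x else 0 :: real)"
  using disjoint_family_onD[OF disjoint, of i j] assms by (auto simp: indicator_def)

lemma cyl_fun_test_cylinder:
  assumes "sets \<mu> = sets borel"
  shows "cyl_fun (test_cylinder g) \<mu>
    = (\<Sum>i<m. poly g (measure \<mu> (C i)) - poly g (measure \<mu> (C (i + m))))"
proof -
  have sp: "space \<mu> = UNIV" using sets_eq_imp_space_eq[OF assms] by simp
  have "cyl_fun (test_cylinder g) \<mu> = (\<Sum>i<2 * m. half_sign i * poly g (measure \<mu> (C i)))"
    by (auto simp: test_cylinder_def integrals_def sp intro!: sum.cong)
  also have "\<dots> = (\<Sum>i<m. half_sign i * poly g (measure \<mu> (C i))) + (\<Sum>i = m..<m + m. half_sign i * poly g (measure \<mu> (C i)))"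
    by (simp add: lessThan_atLeast0 sum.atLeastLessThan_concat mult_2)
  also have "(\<Sum>i = m..<m + m. half_sign i * poly g (measure \<mu> (C i)))
      = (\<Sum>i<m. half_sign (i + m) * poly g (measure \<mu> (C (i + m))))"
    using sum.shift_bounds_nat_ivl[of "\<lambda>i. half_sign i * poly g (measure \<mu> (C i))" 0 m m]
    by (simp add: lessThan_atLeast0)
  finally show ?thesis by (simp add: half_sign_def sum_subtractf sum_negf)
qed

text \<open>The signs make both halves contribute positively: the covariance with the indicator of
  \<open>A\<close> gives weight \<open>1 - \<mu>(A)\<close> to the cells in \<open>A\<close> and \<open>- \<mu>(A)\<close> to the others.\<close>
lemma cov_form_half_test_cylinder:
  fixes \<mu> :: "'a measure" and g :: "real poly"
  assumes "prob_space \<mu>" and sets: "sets \<mu> = sets borel"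
  defines "\<phi> \<equiv> \<lambda>x. x * poly (pderiv g) x"
  shows "cov_form \<mu> (gradient (Cylinder 1 (\<lambda>y. y 0) (\<lambda>_. indicator A)) \<mu>) (gradient (test_cylinder g) \<mu>)
    = (1 - measure \<mu> A) * (\<Sum>i<m. \<phi> (measure \<mu> (C i))) + measure \<mu> A * (\<Sum>i = m..<2 * m. \<phi> (measure \<mu> (C i)))"
proof -
  interpret \<mu>: prob_space \<mu> by fact
  have sp: "space \<mu> = UNIV" using sets_eq_imp_space_eq[OF sets] by simp
  note sets[measurable_cong]
  have cells' [measurable]: "C i \<in> sets \<mu>" if "i < 2 * m" for i using cells[OF that] sets by simp
  let ?w = "\<lambda>i. measure \<mu> (C i)"
  define a where "a i = half_sign i * poly (pderiv g) (?w i)" for i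
  have int: "integrable \<mu> (\<lambda>x. a i * indicator (C i) x)" if "i < 2 * m" for i
    using cells'[OF that] by (intro integrable_mult_right integrable_real_indicator) (auto simp: \<mu>.emeasure_eq_measure)
  have H: "gradient (Cylinder 1 (\<lambda>y. y 0) (\<lambda>_. indicator A)) \<mu> = indicator A"
    by (auto simp: partial_deriv_def fun_eq_iff)
  have G: "gradient (test_cylinder g) \<mu> = (\<lambda>x. \<Sum>i<2 * m. a i * indicator (C i) x)"
    by (auto simp: test_cylinder_def a_def partial_deriv_separated_sum integrals_def sp pderiv_smult fun_eq_iff
          simp del: poly_smult intro!: sum.cong) (simp add: mult.assoc)
  have HG: "indicator A x * (\<Sum>i<2 * m. a i * indicator (C i) x) = (\<Sum>i<m. a i * indicator (C i) x)" for x
  proof -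
    have "indicator A x * (\<Sum>i<2 * m. a i * indicator (C i) x)
      = (\<Sum>j<m. \<Sum>i<2 * m. a i * (indicator (C j) x * indicator (C i) x))"
      unfolding indicator_half sum_product by (simp add: mult_ac)
    also have "\<dots> = (\<Sum>j<m. \<Sum>i<2 * m. if i = j then a i * indicator (C i) x else 0)"
      by (intro sum.cong refl) (auto simp: indicator_cell_mult)
    also have "\<dots> = (\<Sum>j<m. a j * indicator (C j) x)" by (intro sum.cong refl) simp
    finally show ?thesis .
  qed
  have split: "(\<Sum>i<2 * m. a i * ?w i) = (\<Sum>i<m. a i * ?w i) + (\<Sum>i = m..<2 * m. a i * ?w i)"
    by (simp add: lessThan_atLeast0 sum.atLeastLessThan_concat)
  have "cov_form \<mu> (gradient (Cylinder 1 (\<lambda>y. y 0) (\<lambda>_. indicator A)) \<mu>) (gradient (test_cylinder g) \<mu>)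
    = (\<Sum>i<m. a i * ?w i) - measure \<mu> A * (\<Sum>i<2 * m. a i * ?w i)"
  proof -
    have "(\<integral>x. (\<Sum>i<n. a i * indicator (C i) x) \<partial>\<mu>) = (\<Sum>i<n. a i * ?w i)" if "n \<le> 2 * m" for n
      by (subst Bochner_Integration.integral_sum) (use int that in \<open>auto simp: sp\<close>)
    then show ?thesis unfolding cov_form_def H G HG by (simp add: sp)
  qed
  also have "\<dots> = (1 - measure \<mu> A) * (\<Sum>i<m. a i * ?w i) + measure \<mu> A * (- (\<Sum>i = m..<2 * m. a i * ?w i))"
    unfolding split by (simp add: algebra_simps)
  also have "(\<Sum>i<m. a i * ?w i) = (\<Sum>i<m. \<phi> (?w i))"
    by (intro sum.cong) (auto simp: a_def half_sign_def \<phi>_def)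
  also have "- (\<Sum>i = m..<2 * m. a i * ?w i) = (\<Sum>i = m..<2 * m. \<phi> (?w i))"
    unfolding sum_negf[symmetric] by (intro sum.cong) (auto simp: a_def half_sign_def \<phi>_def)
  finally show ?thesis .
qed

end


section \<open>Exchangeability of the cells\<close>
lemma distr_PiM_map:
  assumes "\<And>k. prob_space (M k)" and f: "\<And>k. f k \<in> M k \<rightarrow>\<^sub>M N k"
  shows "distr (\<Pi>\<^sub>M k\<in>UNIV. M k) (\<Pi>\<^sub>M k\<in>UNIV. N k) (\<lambda>\<omega> k. f k (\<omega> k))
    = (\<Pi>\<^sub>M k\<in>UNIV. distr (M k) (N k) (f k))"
proof -
  interpret M: prob_space "M k" for k by fact
  interpret D: prob_space "distr (M k) (N k) (f k)" for k by (rule M.prob_space_distr[OF f])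
  interpret PM: product_prob_space M UNIV ..
  interpret PD: product_prob_space "\<lambda>k. distr (M k) (N k) (f k)" UNIV ..
  have "(\<lambda>\<omega>. f k (\<omega> k)) \<in> PiM UNIV M \<rightarrow>\<^sub>M N k" for k
    by (rule measurable_compose[OF measurable_component_singleton[of k UNIV M, OF UNIV_I] f[of k]])
  then have map [measurable]: "(\<lambda>\<omega> k. f k (\<omega> k)) \<in> PiM UNIV M \<rightarrow>\<^sub>M PiM UNIV N"
    using measurable_space[OF f] by (intro measurable_PiM_single') (auto simp: space_PiM PiE_iff)
  show ?thesis
  proof (rule PD.PiM_eq)
    show "sets (distr (PiM UNIV M) (PiM UNIV N) (\<lambda>\<omega> k. f k (\<omega> k))) = sets (\<Pi>\<^sub>M k\<in>UNIV. distr (M k) (N k) (f k))"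
      by (simp cong: sets_PiM_cong)
    fix J F assume J: "finite J" "J \<subseteq> UNIV" and F: "\<And>j. j \<in> J \<Longrightarrow> F j \<in> sets (distr (M j) (N j) (f j))"
    have emb: "prod_emb UNIV (\<lambda>k. distr (M k) (N k) (f k)) J (Pi\<^sub>E J F)
        = prod_emb UNIV N J (Pi\<^sub>E J F)"
      by (simp add: prod_emb_def)
    have "emeasure (distr (PiM UNIV M) (PiM UNIV N) (\<lambda>\<omega> k. f k (\<omega> k))) (prod_emb UNIV N J (Pi\<^sub>E J F))
        = emeasure (PiM UNIV M) ((\<lambda>\<omega> k. f k (\<omega> k)) -` prod_emb UNIV N J (Pi\<^sub>E J F) \<inter> space (PiM UNIV M))"
      using J F by (intro emeasure_distr sets_PiM_I) auto
    also have "(\<lambda>\<omega> k. f k (\<omega> k)) -` prod_emb UNIV N J (Pi\<^sub>E J F) \<inter> space (PiM UNIV M)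
        = {\<omega> \<in> space (PiM UNIV M). \<forall>j\<in>J. \<omega> j \<in> f j -` F j \<inter> space (M j)}"
      using measurable_space[OF f] by (auto simp: prod_emb_def space_PiM PiE_iff)
    also have "emeasure (PiM UNIV M) \<dots> = (\<Prod>j\<in>J. emeasure (M j) (f j -` F j \<inter> space (M j)))"
      using J F by (intro PM.emeasure_PiM_Collect measurable_sets[OF f]) auto
    also have "\<dots> = (\<Prod>j\<in>J. emeasure (distr (M j) (N j) (f j)) (F j))"
      using F by (intro prod.cong refl emeasure_distr[symmetric] f) auto
    finally show "emeasure (distr (PiM UNIV M) (PiM UNIV N) (\<lambda>\<omega> k. f k (\<omega> k)))
        (prod_emb UNIV (\<lambda>k. distr (M k) (N k) (f k)) J (Pi\<^sub>E J F))
      = (\<Prod>j\<in>J. emeasure (distr (M j) (N j) (f j)) (F j))"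
      unfolding emb .
  qed
qed

lemma power_le_half:
  assumes "0 < n" "1 / real n \<le> w" "w \<le> 1"
  shows "(1 - w) ^ n \<le> 1 / 2"
proof -
  have "(1 - w) ^ n \<le> exp (- 1 / real n) ^ n"
    using assms exp_ge_add_one_self[of "- 1 / real n"] by (intro power_mono) auto
  also have "\<dots> = exp (- 1)" using assms by (simp flip: exp_of_nat_mult)
  also have "\<dots> \<le> 1 / 2" using exp_ge_add_one_self[of 1] by (simp add: exp_minus field_simps)
  finally show ?thesis .
qed

lemma (in prob_space) second_moment_sum_le:
  fixes D :: "nat \<Rightarrow> 'a \<Rightarrow> real"
  assumes [measurable]: "\<And>i. i < m \<Longrightarrow> D i \<in> borel_measurable M"
    and bound: "\<And>i x. i < m \<Longrightarrow> x \<in> space M \<Longrightarrow> \<bar>D i x\<bar> \<le> L"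
    and uncorrelated: "\<And>i j. i < m \<Longrightarrow> j < m \<Longrightarrow> i \<noteq> j \<Longrightarrow> expectation (\<lambda>x. D i x * D j x) = 0"
  shows "expectation (\<lambda>x. (\<Sum>i<m. D i x)\<^sup>2) \<le> real m * L\<^sup>2"
proof -
  have le: "\<bar>D i x * D j x\<bar> \<le> L * L" if "i < m" "j < m" "x \<in> space M" for i j x
    unfolding abs_mult using bound that by (intro mult_mono) (auto intro: order_trans[OF abs_ge_zero])
  have int: "integrable M (\<lambda>x. D i x * D j x)" if "i < m" "j < m" for i j
    using that le by (intro integrable_const_bound[of _ "L * L"]) auto
  have "expectation (\<lambda>x. (\<Sum>i<m. D i x)\<^sup>2) = expectation (\<lambda>x. \<Sum>i<m. \<Sum>j<m. D i x * D j x)"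
    by (simp add: power2_eq_square sum_product)
  also have "\<dots> = (\<Sum>i<m. \<Sum>j<m. expectation (\<lambda>x. D i x * D j x))"
    using int by (subst Bochner_Integration.integral_sum; (intro sum.cong refl Bochner_Integration.integral_sum)?) auto
  also have "\<dots> = (\<Sum>i<m. \<Sum>j<m. if j = i then expectation (\<lambda>x. D i x * D i x) else 0)"
    using uncorrelated by (intro sum.cong refl) auto
  also have "\<dots> = (\<Sum>i<m. expectation (\<lambda>x. D i x * D i x))" by simp
  also have "\<dots> \<le> (\<Sum>i<m. L * L)"
  proof (rule sum_mono)
    fix i assume "i \<in> {..<m}"
    then have i: "i < m" by simp
    have "D i x * D i x \<le> L * L" if "x \<in> space M" for x
      using le[OF i i that] by simp
    then show "expectation (\<lambda>x. D i x * D i x) \<le> L * L"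
      by (intro integral_le_const int i AE_I2)
  qed
  also have "\<dots> = real m * L\<^sup>2" by (simp add: power2_eq_square)
  finally show ?thesis .
qed

context halved_partition
begin

abbreviation "labels \<equiv> (\<Pi>\<^sub>M k\<in>(UNIV :: nat set). \<nu>)"

interpretation labels: product_prob_space "\<lambda>_. \<nu>" "UNIV :: nat set" ..

text \<open>The locations of the atoms matter only through the cells that contain them. Passing to cell
  indices makes the exchange of two cells a map on indices; on \<open>S\<close> there need not be any
  measure-preserving map that exchanges them.\<close>
definition cell :: "'a \<Rightarrow> nat" where
  "cell x = (THE i. i < 2 * m \<and> x \<in> C i)"

lemma cell_eq_iff: "i < 2 * m \<Longrightarrow> cell x = i \<longleftrightarrow> x \<in> C i"
proof -
  assume i: "i < 2 * m"
  obtain j where j: "j < 2 * m" "x \<in> C j" using cover by blast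
  have "cell x = j"
    unfolding cell_def using j disjoint_family_onD[OF disjoint] by (intro the_equality) auto
  with i j show ?thesis using disjoint_family_onD[OF disjoint, of i j] by auto
qed

lemma cell_less: "cell x < 2 * m"
proof -
  obtain j where j: "j < 2 * m" "x \<in> C j" using cover by blast
  then show ?thesis using cell_eq_iff by metis
qed

lemma space_base: "space \<nu> = UNIV"
  using sets_eq_imp_space_eq[OF sets_base] by simp

lemma measurable_cell [measurable]: "cell \<in> \<nu> \<rightarrow>\<^sub>M count_space UNIV"
proof (rule measurable_count_space_eq2_countable[THEN iffD2], simp, safe)
  fix i
  have "cell -` {i} \<inter> space \<nu> = (if i < 2 * m then C i else {})"
    using cell_eq_iff[of i] cell_less by (auto simp: space_base)
  then show "cell -` {i} \<inter> space \<nu> \<in> events"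
    using cells[of i] sets_base by auto
qed

lemma distr_cell_permute:
  assumes "\<tau> permutes {..<2 * m}"
  shows "distr (distr \<nu> (count_space UNIV) cell) (count_space UNIV) \<tau> = distr \<nu> (count_space UNIV) cell"
proof (rule measure_eqI_countable)
  have point: "emeasure (distr \<nu> (count_space UNIV) cell) {i} = (if i < 2 * m then ennreal (1 / real (2 * m)) else 0)" for i
  proof -
    have "cell -` {i} \<inter> space \<nu> = (if i < 2 * m then C i else {})"
      using cell_eq_iff[of i] cell_less by (auto simp: space_base)
    then show ?thesis
      using prob_cell[of i] by (subst emeasure_distr) (auto simp: emeasure_eq_measure)
  qed
  show "emeasure (distr (distr \<nu> (count_space UNIV) cell) (count_space UNIV) \<tau>) {i}
    = emeasure (distr \<nu> (count_space UNIV) cell) {i}" for i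
  proof -
    have "\<tau> -` {i} = {inv \<tau> i}"
      using permutes_inverses[OF assms] by auto
    moreover have "inv \<tau> i < 2 * m \<longleftrightarrow> i < 2 * m"
      using permutes_in_image[OF permutes_inv[OF assms], of i] by simp
    ultimately show ?thesis by (subst emeasure_distr) (auto simp: point)
  qed
qed auto

text \<open>The cell indices of the atoms are independent and uniform on \<open>{..<2 * m}\<close>, hence any permutation
  of the cells preserves their joint law.\<close>

lemma integral_cells_permute:
  fixes F :: "(nat \<Rightarrow> nat) \<Rightarrow> real"
  assumes \<tau>: "\<tau> permutes {..<2 * m}" and [measurable]: "F \<in> borel_measurable (\<Pi>\<^sub>M k\<in>(UNIV :: nat set). count_space UNIV)"
  shows "(\<integral>\<xi>. F (\<lambda>k. \<tau> (cell (\<xi> k))) \<partial>labels) = (\<integral>\<xi>. F (\<lambda>k. cell (\<xi> k)) \<partial>labels)"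
proof -
  let ?N = "\<Pi>\<^sub>M k\<in>(UNIV :: nat set). count_space (UNIV :: nat set)"
  let ?D = "distr \<nu> (count_space UNIV) cell"
  interpret D: prob_space ?D by (rule prob_space_distr) measurable
  have Z: "distr labels ?N (\<lambda>\<xi> k. cell (\<xi> k)) = (\<Pi>\<^sub>M k\<in>(UNIV :: nat set). ?D)"
    by (rule distr_PiM_map) (auto intro: prob_space_axioms)
  have \<tau>D: "\<tau> \<in> ?D \<rightarrow>\<^sub>M count_space UNIV" by simp
  have "distr (\<Pi>\<^sub>M k\<in>(UNIV :: nat set). ?D) ?N (\<lambda>z k. \<tau> (z k)) = (\<Pi>\<^sub>M k\<in>(UNIV :: nat set). distr ?D (count_space UNIV) \<tau>)"
    by (rule distr_PiM_map[OF D.prob_space_axioms \<tau>D])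
  then have T: "distr (distr labels ?N (\<lambda>\<xi> k. cell (\<xi> k))) ?N (\<lambda>z k. \<tau> (z k)) = distr labels ?N (\<lambda>\<xi> k. cell (\<xi> k))"
    by (simp add: Z distr_cell_permute[OF \<tau>])
  have [measurable]: "(\<lambda>\<xi> k. cell (\<xi> k)) \<in> labels \<rightarrow>\<^sub>M ?N"
    by (rule measurable_PiM_single') auto
  have [measurable]: "(\<lambda>z k. \<tau> (z k)) \<in> ?N \<rightarrow>\<^sub>M ?N"
    by (rule measurable_PiM_single') auto
  have "(\<integral>\<xi>. F (\<lambda>k. \<tau> (cell (\<xi> k))) \<partial>labels)
      = (\<integral>z. F z \<partial>distr (distr labels ?N (\<lambda>\<xi> k. cell (\<xi> k))) ?N (\<lambda>z k. \<tau> (z k)))"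
    by (subst integral_distr, measurable, subst integral_distr, measurable)
  also have "\<dots> = (\<integral>\<xi>. F (\<lambda>k. cell (\<xi> k)) \<partial>labels)"
    unfolding T by (subst integral_distr) measurable
  finally show ?thesis .
qed

definition cell_mass :: "(nat \<Rightarrow> real) \<Rightarrow> (nat \<Rightarrow> nat) \<Rightarrow> nat \<Rightarrow> real" where
  "cell_mass p z i = enn2real (\<Sum>k. ennreal (p k) * indicator {i} (z k))"

lemma measurable_cell_mass [measurable]:
  "(\<lambda>z. cell_mass p z i) \<in> borel_measurable (\<Pi>\<^sub>M k\<in>(UNIV :: nat set). count_space UNIV)"
proof -
  have [measurable]: "(\<lambda>z. indicator {i} (z k) :: ennreal) \<in> borel_measurable (\<Pi>\<^sub>M k\<in>(UNIV :: nat set). count_space UNIV)" for k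
    by (rule measurable_compose[OF measurable_component_singleton[OF UNIV_I]]) simp
  show ?thesis unfolding cell_mass_def by measurable
qed

lemma measure_random_measure_cell:
  assumes "valid_sticks u" "i < 2 * m"
  shows "measure (random_measure \<nu> u \<xi>) (C i) = cell_mass (descending (stick_breaking u)) (\<lambda>k. cell (\<xi> k)) i"
proof -
  have "indicator (C i) (\<xi> k) = (indicator {i} (cell (\<xi> k)) :: ennreal)" for k
    using cell_eq_iff[OF assms(2), of "\<xi> k"] by (simp add: indicator_def)
  then show ?thesis
    using assms cells[of i]
    by (simp add: measure_def random_measure_valid emeasure_atomic_measure cell_mass_def)
qed

lemma cell_mass_permute:
  assumes "\<tau> permutes {..<2 * m}"
  shows "cell_mass p (\<lambda>k. \<tau> (z k)) (\<tau> i) = cell_mass p z i"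
  using permutes_inj[OF assms] unfolding cell_mass_def indicator_def by (simp add: inj_eq)

lemma measurable_measure_random_measure:
  assumes "S \<in> sets borel"
  shows "(\<lambda>\<xi>. measure (random_measure \<nu> u \<xi>) S) \<in> borel_measurable labels"
proof -
  have "(\<lambda>\<xi>. (case (u, \<xi>) of (u, \<xi>) \<Rightarrow> random_measure \<nu> u \<xi>)) \<in> labels \<rightarrow>\<^sub>M prob_algebra borel"
    using measurable_random_measure[OF prob_space_axioms sets_base]
    by (rule measurable_compose[rotated]) (auto simp: space_PiM)
  then show ?thesis
    using assms by (auto intro: measurable_compose[OF _ measurable_measure_prob_algebra])
qed

text \<open>The differences in the test function are orthogonal given the sticks, since the exchange of the
  cells \<open>i\<close> and \<open>i + m\<close> negates the \<open>i\<close>-th difference and fixes the others. For invalid sticks the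
  random measure is \<open>\<nu>\<close>, whose cell masses are all equal, and every difference vanishes.\<close>
lemma second_moment_test_function_given_sticks:
  fixes g :: "real poly"
  assumes bounds: "\<And>x. 0 \<le> x \<Longrightarrow> x \<le> 1 \<Longrightarrow> poly g x \<in> {- L..0}"
  shows "(\<integral>\<xi>. (cyl_fun (test_cylinder g) (random_measure \<nu> u \<xi>))\<^sup>2 \<partial>labels) \<le> real m * L\<^sup>2"
proof -
  define D where "D i \<xi> = poly g (measure (random_measure \<nu> u \<xi>) (C i))
      - poly g (measure (random_measure \<nu> u \<xi>) (C (i + m)))" for i \<xi>
  have prob: "prob_space (random_measure \<nu> u \<xi>)" for \<xi>
    by (rule prob_space_random_measure) unfold_locales
  have sets_eq: "sets (random_measure \<nu> u \<xi>) = sets borel" for \<xi>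
    using sets_base by (simp add: random_measure_def)
  have "(\<integral>\<xi>. (\<Sum>i<m. D i \<xi>)\<^sup>2 \<partial>labels) \<le> real m * L\<^sup>2"
  proof (rule labels.second_moment_sum_le)
    fix i assume i: "i < m"
    show "D i \<in> borel_measurable labels"
      unfolding D_def using i cells
      by (intro borel_measurable_diff measurable_compose[OF measurable_measure_random_measure]
            borel_measurable_continuous_onI continuous_intros) auto
    fix \<xi> :: "nat \<Rightarrow> 'a"
    interpret \<mu>: prob_space "random_measure \<nu> u \<xi>" by (rule prob)
    show "\<bar>D i \<xi>\<bar> \<le> L"
      using bounds[of "\<mu>.prob (C i)"] bounds[of "\<mu>.prob (C (i + m))"] by (auto simp: D_def)
  next
    fix i j assume ij: "i < m" "j < m" "i \<noteq> j"
    show "(\<integral>\<xi>. D i \<xi> * D j \<xi> \<partial>labels) = 0"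
    proof (cases "valid_sticks u")
      case True
      let ?p = "descending (stick_breaking u)"
      define \<tau> where "\<tau> = Transposition.transpose i (i + m)"
      have \<tau>: "\<tau> permutes {..<2 * m}"
        unfolding \<tau>_def using ij by (intro permutes_swap_id) auto
      define E where "E i z = poly g (cell_mass ?p z i) - poly g (cell_mass ?p z (i + m))" for i z
      have D: "D l \<xi> = E l (\<lambda>k. cell (\<xi> k))" if "l < m" for l \<xi>
        unfolding D_def E_def using that True by (simp add: measure_random_measure_cell)
      have [measurable]: "E l \<in> borel_measurable (\<Pi>\<^sub>M k\<in>(UNIV :: nat set). count_space UNIV)" for l
        unfolding E_def
        by (intro borel_measurable_diff measurable_compose[OF measurable_cell_mass]
            borel_measurable_continuous_onI continuous_intros)
      have \<tau>_vals: "\<tau> i = i + m" "\<tau> (i + m) = i" "\<tau> j = j" "\<tau> (j + m) = j + m"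
        using ij by (auto simp: \<tau>_def Transposition.transpose_def)
      have flip: "E i (\<lambda>k. \<tau> (z k)) = - E i z" "E j (\<lambda>k. \<tau> (z k)) = E j z" for z
        using cell_mass_permute[OF \<tau>, of ?p z i] cell_mass_permute[OF \<tau>, of ?p z "i + m"]
          cell_mass_permute[OF \<tau>, of ?p z j] cell_mass_permute[OF \<tau>, of ?p z "j + m"]
        by (simp_all add: E_def \<tau>_vals)
      have "(\<integral>\<xi>. E i (\<lambda>k. \<tau> (cell (\<xi> k))) * E j (\<lambda>k. \<tau> (cell (\<xi> k))) \<partial>labels)
          = (\<integral>\<xi>. E i (\<lambda>k. cell (\<xi> k)) * E j (\<lambda>k. cell (\<xi> k)) \<partial>labels)"
        by (rule integral_cells_permute[OF \<tau>, of "\<lambda>z. E i z * E j z"]) measurable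
      then have "(\<integral>\<xi>. E i (\<lambda>k. cell (\<xi> k)) * E j (\<lambda>k. cell (\<xi> k)) \<partial>labels) = 0"
        by (simp add: flip)
      then show ?thesis using ij by (simp add: D)
    next
      case False
      then show ?thesis using ij by (simp add: D_def random_measure_valid prob_cell)
    qed
  qed
  then show ?thesis
    unfolding D_def using cyl_fun_test_cylinder[OF sets_eq] by simp
qed

section \<open>Energy given the sticks\<close>

text \<open>The label 0 avoids \<open>A\<close> with probability \<open>1/2\<close>. Independently, \<open>2 m\<close> further labels all miss a cell
  of mass \<open>1 / (2 m)\<close> with probability at most \<open>1/2\<close>.\<close>
lemma prob_cell_hit:
  assumes "i < m"
  shows "{\<xi>. \<xi> 0 \<notin> A \<and> (\<exists>k\<in>{1..2 * m}. \<xi> k \<in> C i)} \<in> sets labels"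
    and "1 / 4 \<le> measure labels {\<xi>. \<xi> 0 \<notin> A \<and> (\<exists>k\<in>{1..2 * m}. \<xi> k \<in> C i)}"
proof -
  have i: "i < 2 * m" using assms by simp
  define n where "n = 2 * m"
  have "n \<ge> 1" using m_pos by (simp add: n_def)
  have prob_A: "prob (UNIV - A) = 1 / 2"
  proof -
    have "prob A = (\<Sum>i<m. prob (C i))"
      unfolding half using cells sets_base disjoint
      by (intro finite_measure_finite_Union) (auto intro: disjoint_family_on_mono[OF _ disjoint])
    also have "\<dots> = (\<Sum>i<m. 1 / real (2 * m))" by (intro sum.cong refl prob_cell) auto
    also have "\<dots> = 1 / 2" using m_pos by simp
    finally show ?thesis using prob_compl[of A] half_borel sets_base by (simp add: space_base)
  qed
  have prob_C: "prob (UNIV - C i) = 1 - 1 / real n"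
    using prob_compl[of "C i"] cells[OF i] prob_cell[OF i] sets_base by (simp add: space_base n_def)
  define avoid where "avoid J = {\<xi> :: nat \<Rightarrow> 'a. \<forall>k\<in>J. \<xi> k \<in> (if k = 0 then UNIV - A else UNIV - C i)}" for J
  have sets_ev: "UNIV - A \<in> events" "UNIV - C i \<in> events"
    using half_borel cells[OF i] sets_base by (auto intro!: borel_comp)
  have avoid_meas: "avoid J \<in> sets labels" if "finite J" for J
  proof -
    have "{\<xi> \<in> space labels. \<forall>k\<in>J. \<xi> k \<in> (if k = 0 then UNIV - A else UNIV - C i)} \<in> sets labels"
      using sets_ev that by (intro sets.sets_Collect_finite_All sets_Collect_single) auto
    then show ?thesis by (simp add: avoid_def space_PiM space_base)
  qed
  have prob_avoid: "measure labels (avoid J) = (\<Prod>k\<in>J. prob (if k = 0 then UNIV - A else UNIV - C i))" if "finite J" for J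
    using labels.emeasure_PiM_Collect[of J "\<lambda>k. if k = 0 then UNIV - A else UNIV - C i"] that sets_ev
    unfolding avoid_def
    by (simp add: space_PiM space_base labels.emeasure_eq_measure emeasure_eq_measure prod_ennreal prod_nonneg)
  have small: "(1 - 1 / real n) ^ n \<le> 1 / 2"
    using \<open>n \<ge> 1\<close> by (intro power_le_half) auto
  have hit: "{\<xi>. \<xi> 0 \<notin> A \<and> (\<exists>k\<in>{1..2 * m}. \<xi> k \<in> C i)} = avoid {0} - avoid {0..n}"
  proof -
    have "{0..n} = insert 0 {1..n}" by auto
    then have "avoid {0..n} = {\<xi>. \<xi> 0 \<notin> A \<and> (\<forall>k\<in>{1..n}. \<xi> k \<notin> C i)}"
      by (auto simp: avoid_def)
    moreover have "avoid {0} = {\<xi>. \<xi> 0 \<notin> A}" by (auto simp: avoid_def)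
    ultimately show ?thesis by (auto simp: n_def)
  qed
  show "{\<xi>. \<xi> 0 \<notin> A \<and> (\<exists>k\<in>{1..2 * m}. \<xi> k \<in> C i)} \<in> sets labels"
    unfolding hit by (intro sets.Diff avoid_meas) auto
  have "measure labels (avoid {0} - avoid {0..n}) = measure labels (avoid {0}) - measure labels (avoid {0..n})"
    by (intro labels.finite_measure_Diff avoid_meas) (auto simp: avoid_def)
  also have "\<dots> = 1 / 2 - 1 / 2 * (1 - 1 / real n) ^ n"
  proof -
    have "(\<Prod>k\<in>{0..n}. prob (if k = 0 then UNIV - A else UNIV - C i)) = 1 / 2 * (\<Prod>k\<in>{1..n}. 1 - 1 / real n)"
      by (subst prod.atLeast_Suc_atMost) (auto simp: prob_A prob_C intro!: prod.cong)
    then show ?thesis by (simp add: prob_avoid prob_A)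
  qed
  finally show "1 / 4 \<le> measure labels {\<xi>. \<xi> 0 \<notin> A \<and> (\<exists>k\<in>{1..2 * m}. \<xi> k \<in> C i)}"
    unfolding hit using small by simp
qed

text \<open>If the largest atom lies outside \<open>A\<close>, then \<open>1 - \<mu>(A)\<close> is at least \<open>c\<close>. If one of the next
  \<open>2 m\<close> atoms, each of mass at least \<open>1 / M\<close>, lies in cell \<open>i\<close>, then the \<open>i\<close>-th summand is at least
  \<open>1/2\<close>. Both happen together with probability at least \<open>1/4\<close>.\<close>
lemma energy_density_given_sticks:
  assumes u: "valid_sticks u" and c: "0 \<le> c" and big: "c \<le> stick_breaking u 0"
    and many: "\<And>k. k \<le> 2 * m \<Longrightarrow> 1 / real M \<le> stick_breaking u k" and M: "M > 0"
  shows "real m * c / 8 \<le> (\<integral>\<xi>. (1 - measure (random_measure \<nu> u \<xi>) A)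
      * (\<Sum>i<m. 1 - (1 - measure (random_measure \<nu> u \<xi>) (C i)) ^ M) \<partial>labels)"
proof -
  let ?\<mu> = "random_measure \<nu> u"
  let ?p = "descending (stick_breaking u)"
  have sets_eq: "sets (?\<mu> \<xi>) = sets borel" for \<xi>
    using sets_base by (simp add: random_measure_def)
  have prob: "prob_space (?\<mu> \<xi>)" for \<xi>
    by (rule prob_space_random_measure) unfold_locales
  have atom: "?p k \<le> measure (?\<mu> \<xi>) S" if "S \<in> sets borel" "\<xi> k \<in> S" for k S \<xi>
  proof -
    interpret \<mu>: prob_space "?\<mu> \<xi>" by (rule prob)
    have "ennreal (?p k) = (\<Sum>l\<in>{k}. ennreal (?p l) * indicator S (\<xi> l))" using that by simp
    also have "\<dots> \<le> (\<Sum>l. ennreal (?p l) * indicator S (\<xi> l))" by (rule sum_le_suminf) auto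
    also have "\<dots> = emeasure (?\<mu> \<xi>) S" using that u by (simp add: random_measure_valid emeasure_atomic_measure)
    finally show ?thesis by (simp add: \<mu>.emeasure_eq_measure)
  qed
  let ?hit = "\<lambda>i. {\<xi>. \<xi> 0 \<notin> A \<and> (\<exists>k\<in>{1..2 * m}. \<xi> k \<in> C i)}"
  let ?f = "\<lambda>i \<xi>. (1 - measure (?\<mu> \<xi>) A) * (1 - (1 - measure (?\<mu> \<xi>) (C i)) ^ M)"
  have f_bounds: "0 \<le> ?f i \<xi>" "?f i \<xi> \<le> 1" for i \<xi>
  proof -
    interpret \<mu>: prob_space "?\<mu> \<xi>" by (rule prob)
    have "0 \<le> (1 - \<mu>.prob (C i)) ^ M" "(1 - \<mu>.prob (C i)) ^ M \<le> 1" by (auto intro: power_le_one)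
    then show "0 \<le> ?f i \<xi>" "?f i \<xi> \<le> 1" by (auto intro!: mult_nonneg_nonneg mult_le_one)
  qed
  have f_meas [measurable]: "?f i \<in> borel_measurable labels" if "i < m" for i
    using that cells[of i] half_borel
    by (intro borel_measurable_times borel_measurable_diff borel_measurable_power
          measurable_measure_random_measure) auto
  have f_int: "integrable labels (?f i)" if "i < m" for i
    using f_meas[OF that] f_bounds by (intro labels.integrable_const_bound[of _ 1]) auto
  have f_lower: "c / 2 * indicator (?hit i) \<xi> \<le> ?f i \<xi>" if "i < m" for i \<xi>
  proof (cases "\<xi> \<in> ?hit i")
    case True
    interpret \<mu>: prob_space "?\<mu> \<xi>" by (rule prob)
    from True obtain k where k: "k \<in> {1..2 * m}" "\<xi> k \<in> C i" and 0: "\<xi> 0 \<in> UNIV - A" by auto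
    have "c \<le> ?p 0"
      using descending_sticks_lower_bound[OF u, of 0 c 0] big by simp
    also have "\<dots> \<le> \<mu>.prob (UNIV - A)" using 0 half_borel by (intro atom) auto
    also have "\<dots> = 1 - \<mu>.prob A"
      using \<mu>.prob_compl[of A] half_borel sets_eq sets_eq_imp_space_eq[OF sets_eq] by simp
    finally have c_le: "c \<le> 1 - \<mu>.prob A" .
    have "1 / real M \<le> ?p k"
      using descending_sticks_lower_bound[OF u many, of "2 * m" k] k by simp
    also have "\<dots> \<le> \<mu>.prob (C i)" using k that cells by (intro atom) auto
    finally have "1 / 2 \<le> 1 - (1 - \<mu>.prob (C i)) ^ M" using power_le_half[OF M, of "\<mu>.prob (C i)"] by simp
    with c_le have "c * (1 / 2) \<le> ?f i \<xi>" by (intro mult_mono) auto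
    with True show ?thesis by simp
  next
    case False
    then have "indicator (?hit i) \<xi> = (0 :: real)" by (rule indicator_simps(2))
    then show ?thesis using f_bounds(1)[of \<xi> i] by (simp only: mult_zero_right)
  qed
  have "c / 8 \<le> (\<integral>\<xi>. ?f i \<xi> \<partial>labels)" if "i < m" for i
  proof -
    have "c / 2 * (1 / 4) \<le> c / 2 * measure labels (?hit i)"
      using c prob_cell_hit(2)[OF that] by (intro mult_left_mono) auto
    also have "\<dots> = (\<integral>\<xi>. c / 2 * indicator (?hit i) \<xi> \<partial>labels)"
      using prob_cell_hit(1)[OF that] by (simp add: space_PiM space_base)
    also have "\<dots> \<le> (\<integral>\<xi>. ?f i \<xi> \<partial>labels)"
      using prob_cell_hit(1)[OF that] f_lower[OF that] f_int[OF that]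
      by (intro integral_mono integrable_mult_right integrable_real_indicator) (auto simp: labels.emeasure_eq_measure)
    finally show ?thesis by simp
  qed
  then have "(\<Sum>i<m. c / 8) \<le> (\<Sum>i<m. \<integral>\<xi>. ?f i \<xi> \<partial>labels)" by (intro sum_mono) auto
  then have "real m * c / 8 \<le> (\<Sum>i<m. \<integral>\<xi>. ?f i \<xi> \<partial>labels)" by simp
  also have "\<dots> = (\<integral>\<xi>. (1 - measure (?\<mu> \<xi>) A) * (\<Sum>i<m. 1 - (1 - measure (?\<mu> \<xi>) (C i)) ^ M) \<partial>labels)"
    using f_int by (subst Bochner_Integration.integral_sum[symmetric]) (auto simp: sum_distrib_left)
  finally show ?thesis .
qed

end


section \<open>Integration over the sticks\<close>

text \<open>The Cauchy-Schwarz inequality in its additive form; the weight \<open>t\<close> is chosen at the end.\<close>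
lemma integral_mult_le_square_integrable:
  assumes f: "square_integrable M f" and g: "square_integrable M g" and "t > 0"
  shows "(\<integral>x. f x * g x \<partial>M) \<le> (t * (\<integral>x. (f x)\<^sup>2 \<partial>M) + (\<integral>x. (g x)\<^sup>2 \<partial>M) / t) / 2"
proof -
  have [measurable]: "f \<in> borel_measurable M" "g \<in> borel_measurable M"
    and sq: "integrable M (\<lambda>x. (f x)\<^sup>2)" "integrable M (\<lambda>x. (g x)\<^sup>2)"
    using f g by (auto simp: square_integrable_def)
  have young: "\<bar>f x * g x\<bar> \<le> (t * (f x)\<^sup>2 + (g x)\<^sup>2 / t) / 2" for x
  proof -
    have "0 \<le> (t * \<bar>f x\<bar> - \<bar>g x\<bar>)\<^sup>2 / t" using \<open>t > 0\<close> by simp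
    then show ?thesis using \<open>t > 0\<close> by (simp add: abs_mult power2_eq_square field_simps)
  qed
  have int: "integrable M (\<lambda>x. (t * (f x)\<^sup>2 + (g x)\<^sup>2 / t) / 2)" using sq by simp
  have "integrable M (\<lambda>x. f x * g x)"
  proof (rule Bochner_Integration.integrable_bound[OF int])
    show "AE x in M. norm (f x * g x) \<le> norm ((t * (f x)\<^sup>2 + (g x)\<^sup>2 / t) / 2)"
      unfolding real_norm_def by (intro AE_I2 order_trans[OF young abs_ge_self])
  qed measurable
  then have "(\<integral>x. f x * g x \<partial>M) \<le> (\<integral>x. (t * (f x)\<^sup>2 + (g x)\<^sup>2 / t) / 2 \<partial>M)"
    by (intro integral_mono int abs_le_D1[OF young])
  also have "\<dots> = (t * (\<integral>x. (f x)\<^sup>2 \<partial>M) + (\<integral>x. (g x)\<^sup>2 \<partial>M) / t) / 2" using sq by simp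
  finally show ?thesis .
qed

lemma (in prob_space) expectation_ge_off_event:
  fixes f :: "'a \<Rightarrow> real"
  assumes "integrable M f" "\<And>x. x \<in> space M \<Longrightarrow> 0 \<le> f x" "S \<in> events" "0 \<le> c"
    "AE x in M. x \<notin> S \<longrightarrow> c \<le> f x"
  shows "c * (1 - prob S) \<le> expectation f"
proof -
  have "c * (1 - prob S) = expectation (\<lambda>x. c * indicator (space M - S) x)"
    using assms(3) by (simp add: prob_compl)
  also have "\<dots> \<le> expectation f"
  proof (rule integral_mono_AE)
    show "AE x in M. c * indicator (space M - S) x \<le> f x"
      using assms(5) by (rule AE_mp) (use assms(2,4) in \<open>auto simp: indicator_def\<close>)
  qed (use assms in \<open>auto simp: emeasure_eq_measure intro!: integrable_mult_right integrable_real_indicator\<close>)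
  finally show ?thesis .
qed

context halved_partition
begin

interpretation labels: product_prob_space "\<lambda>_. \<nu>" "UNIV :: nat set" ..

interpretation sticks_labels: pair_prob_space stick_measure labels ..

abbreviation "law \<equiv> dirichlet_process (1 / 2) 0 \<nu>"

lemma law_eq:
  "law = distr (stick_measure \<Otimes>\<^sub>M labels) (prob_algebra borel) (\<lambda>(u, \<xi>). random_measure \<nu> u \<xi>)"
  by (simp add: dirichlet_process_def)

lemma sets_law [simp, measurable_cong]: "sets law = sets (prob_algebra borel)"
  and space_law: "space law = space (prob_algebra borel)"
  by (simp_all add: law_eq)

lemma random_measure_measurable [measurable]:
  "(\<lambda>(u, \<xi>). random_measure \<nu> u \<xi>) \<in> stick_measure \<Otimes>\<^sub>M labels \<rightarrow>\<^sub>M prob_algebra borel"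
  by (rule measurable_random_measure) (unfold_locales, rule sets_base)

lemma random_measure_in_space: "random_measure \<nu> u \<xi> \<in> space (prob_algebra borel)"
  using prob_space_random_measure[OF prob_space_axioms] sets_base
  by (simp add: space_prob_algebra random_measure_def)

lemma integral_law:
  fixes f :: "'a measure \<Rightarrow> real"
  assumes [measurable]: "f \<in> borel_measurable (prob_algebra borel)"
    and bound: "\<And>\<mu>. \<mu> \<in> space (prob_algebra borel) \<Longrightarrow> \<bar>f \<mu>\<bar> \<le> K"
  shows "integrable law f"
    and "integrable stick_measure (\<lambda>u. \<integral>\<xi>. f (random_measure \<nu> u \<xi>) \<partial>labels)"
    and "(\<integral>\<mu>. f \<mu> \<partial>law) = (\<integral>u. (\<integral>\<xi>. f (random_measure \<nu> u \<xi>) \<partial>labels) \<partial>stick_measure)"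
proof -
  interpret law: prob_space law
    unfolding law_eq by (rule sticks_labels.P.prob_space_distr) measurable
  show "integrable law f"
    by (rule law.integrable_const_bound[of _ K]) (auto intro!: AE_I2 bound simp: space_law)
  have int: "integrable (stick_measure \<Otimes>\<^sub>M labels) (\<lambda>(u, \<xi>). f (random_measure \<nu> u \<xi>))"
  proof (rule sticks_labels.P.integrable_const_bound[of _ K])
    show "(\<lambda>(u, \<xi>). f (random_measure \<nu> u \<xi>)) \<in> borel_measurable (stick_measure \<Otimes>\<^sub>M labels)"
      using measurable_compose[OF random_measure_measurable assms(1)] by (simp add: case_prod_unfold)
  qed (auto intro!: AE_I2 bound random_measure_in_space)
  show "integrable stick_measure (\<lambda>u. \<integral>\<xi>. f (random_measure \<nu> u \<xi>) \<partial>labels)"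
    using sticks_labels.integrable_fst[OF int] by simp
  have "(\<integral>\<mu>. f \<mu> \<partial>law) = (\<integral>w. f (case w of (u, \<xi>) \<Rightarrow> random_measure \<nu> u \<xi>) \<partial>(stick_measure \<Otimes>\<^sub>M labels))"
    unfolding law_eq by (rule integral_distr) measurable
  also have "\<dots> = (\<integral>w. (case w of (u, \<xi>) \<Rightarrow> f (random_measure \<nu> u \<xi>)) \<partial>(stick_measure \<Otimes>\<^sub>M labels))"
    by (intro Bochner_Integration.integral_cong) auto
  also have "\<dots> = (\<integral>u. (\<integral>\<xi>. f (random_measure \<nu> u \<xi>) \<partial>labels) \<partial>stick_measure)"
    using sticks_labels.integral_fst'[OF int] by simp
  finally show "(\<integral>\<mu>. f \<mu> \<partial>law) = (\<integral>u. (\<integral>\<xi>. f (random_measure \<nu> u \<xi>) \<partial>labels) \<partial>stick_measure)" .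
qed

abbreviation "half_cylinder \<equiv> Cylinder 1 (\<lambda>y. y 0) (\<lambda>_. indicator A)"

lemma prob_bounds:
  assumes "\<mu> \<in> space (prob_algebra borel)"
  shows "measure \<mu> S \<le> 1" "0 \<le> measure \<mu> S"
proof -
  interpret \<mu>: prob_space \<mu> using assms by (simp add: space_prob_algebra)
  show "measure \<mu> S \<le> 1" "0 \<le> measure \<mu> S" by auto
qed

lemma second_moment_test_cylinder:
  fixes r :: nat
  defines "G \<equiv> cyl_fun (test_cylinder (log_poly (2 ^ r)))"
  shows "square_integrable law G" and "(\<integral>\<mu>. (G \<mu>)\<^sup>2 \<partial>law) \<le> real m * (1 + real r)\<^sup>2"
proof -
  let ?g = "log_poly (2 ^ r)"
  let ?D = "\<lambda>\<mu>. \<Sum>i<m. poly ?g (measure \<mu> (C i)) - poly ?g (measure \<mu> (C (i + m)))"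
  have G: "G \<mu> = ?D \<mu>" if "\<mu> \<in> space (prob_algebra borel)" for \<mu>
    unfolding G_def using that by (intro cyl_fun_test_cylinder) (simp add: space_prob_algebra)
  have [measurable]: "?D \<in> borel_measurable (prob_algebra borel)"
    using cells
    by (intro borel_measurable_sum borel_measurable_diff
          measurable_compose[OF measurable_measure_prob_algebra] borel_measurable_continuous_onI continuous_intros) auto
  have G_meas: "G \<in> borel_measurable (prob_algebra borel)"
    by (rule measurable_cong[THEN iffD2, OF G]) simp_all
  have D_bound: "\<bar>?D \<mu>\<bar> \<le> real m * (1 + real r)" if "\<mu> \<in> space (prob_algebra borel)" for \<mu>
  proof -
    have "\<bar>?D \<mu>\<bar> \<le> (\<Sum>i<m. \<bar>poly ?g (measure \<mu> (C i)) - poly ?g (measure \<mu> (C (i + m)))\<bar>)" by (rule sum_abs)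
    also have "\<dots> \<le> (\<Sum>i<m. 1 + real r)"
    proof (rule sum_mono)
      fix i
      show "\<bar>poly ?g (measure \<mu> (C i)) - poly ?g (measure \<mu> (C (i + m)))\<bar> \<le> 1 + real r"
        using log_poly_bounds[of "measure \<mu> (C i)" r] log_poly_bounds[of "measure \<mu> (C (i + m))" r]
          prob_bounds[OF that] by auto
    qed
    finally show ?thesis by simp
  qed
  have sq_bound: "\<bar>(G \<mu>)\<^sup>2\<bar> \<le> (real m * (1 + real r))\<^sup>2" if "\<mu> \<in> space (prob_algebra borel)" for \<mu>
    using power_mono[OF D_bound[OF that] abs_ge_zero, of 2] G[OF that] by simp
  have sq_meas: "(\<lambda>\<mu>. (G \<mu>)\<^sup>2) \<in> borel_measurable (prob_algebra borel)"
    using G_meas by (rule borel_measurable_power)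
  note law = integral_law[OF sq_meas sq_bound]
  show "square_integrable law G"
    unfolding square_integrable_def using G_meas law(1) by (simp cong: measurable_cong_sets)
  have "(\<integral>\<xi>. (G (random_measure \<nu> u \<xi>))\<^sup>2 \<partial>labels) \<le> real m * (1 + real r)\<^sup>2" for u
    unfolding G_def using log_poly_bounds by (intro second_moment_test_function_given_sticks) simp
  then have "(\<integral>u. (\<integral>\<xi>. (G (random_measure \<nu> u \<xi>))\<^sup>2 \<partial>labels) \<partial>stick_measure) \<le> real m * (1 + real r)\<^sup>2"
    by (intro sticks.P.integral_le_const law(2) AE_I2)
  then show "(\<integral>\<mu>. (G \<mu>)\<^sup>2 \<partial>law) \<le> real m * (1 + real r)\<^sup>2" by (simp only: law(3))
qed

lemma energy_test_cylinder:
  assumes d: "d > 0"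
    and sticks: "measure stick_measure {u. \<not> (d \<le> stick_breaking u 0 \<and>
            (\<forall>k\<le>2 * m. d / (real (2 * m) + 1) ^ 5 \<le> stick_breaking u k))} \<le> 1 / 2"
    and r: "(real (2 * m) + 1) ^ 5 / d \<le> 2 ^ r"
  shows "real m * d / 32 \<le> energy law half_cylinder (test_cylinder (log_poly (2 ^ r)))"
proof -
  define M :: nat where "M = 2 ^ r"
  let ?h = "\<lambda>w :: real. 1 - (1 - w) ^ M"
  let ?J = "\<lambda>\<mu>. (1 - measure \<mu> A) * (\<Sum>i<m. ?h (measure \<mu> (C i)))"
  let ?J' = "\<lambda>\<mu>. measure \<mu> A * (\<Sum>i = m..<2 * m. ?h (measure \<mu> (C i)))"
  have h: "0 \<le> ?h (measure \<mu> S)" "?h (measure \<mu> S) \<le> 1" if "\<mu> \<in> space (prob_algebra borel)" for \<mu> S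
    using prob_bounds[OF that, of S] by (auto intro: power_le_one)
  have J_nonneg: "0 \<le> ?J \<mu>" "0 \<le> ?J' \<mu>" if "\<mu> \<in> space (prob_algebra borel)" for \<mu>
    using h[OF that] prob_bounds[OF that] by (auto intro!: mult_nonneg_nonneg sum_nonneg)
  have J_le: "?J \<mu> \<le> real m" "?J' \<mu> \<le> real m" if "\<mu> \<in> space (prob_algebra borel)" for \<mu>
  proof -
    have "(\<Sum>i<m. ?h (measure \<mu> (C i))) \<le> real m" "(\<Sum>i = m..<2 * m. ?h (measure \<mu> (C i))) \<le> real m"
      using sum_bounded_above[of "{..<m}" "\<lambda>i. ?h (measure \<mu> (C i))" 1]
        sum_bounded_above[of "{m..<2 * m}" "\<lambda>i. ?h (measure \<mu> (C i))" 1] h(2)[OF that] by simp_all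
    moreover have "0 \<le> (\<Sum>i<m. ?h (measure \<mu> (C i)))" "0 \<le> (\<Sum>i = m..<2 * m. ?h (measure \<mu> (C i)))"
      by (rule sum_nonneg, rule h(1)[OF that])+
    moreover have "1 - measure \<mu> A \<le> 1" "measure \<mu> A \<le> 1" using prob_bounds[OF that] by simp_all
    ultimately have "?J \<mu> \<le> 1 * real m" "?J' \<mu> \<le> 1 * real m"
      by (intro mult_mono; simp only: zero_le_one)+
    then show "?J \<mu> \<le> real m" "?J' \<mu> \<le> real m" by simp_all
  qed
  have [measurable]: "?J \<in> borel_measurable (prob_algebra borel)" "?J' \<in> borel_measurable (prob_algebra borel)"
    using cells half_borel
    by (auto intro!: borel_measurable_times borel_measurable_diff borel_measurable_sum borel_measurable_power
          measurable_measure_prob_algebra)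
  have J_law: "integrable law ?J"
    "integrable stick_measure (\<lambda>u. \<integral>\<xi>. ?J (random_measure \<nu> u \<xi>) \<partial>labels)"
    "(\<integral>\<mu>. ?J \<mu> \<partial>law) = (\<integral>u. (\<integral>\<xi>. ?J (random_measure \<nu> u \<xi>) \<partial>labels) \<partial>stick_measure)"
    by (rule integral_law[where K = "real m"]; use J_nonneg J_le in \<open>simp add: abs_le_iff\<close>)+
  have J'_law: "integrable law ?J'"
    by (rule integral_law[where K = "real m"]; use J_nonneg J_le in \<open>simp add: abs_le_iff\<close>)
  define bad where "bad = {u. \<not> (d \<le> stick_breaking u 0 \<and>
            (\<forall>k\<le>2 * m. d / (real (2 * m) + 1) ^ 5 \<le> stick_breaking u k))}"
  have bad_meas: "bad \<in> sticks.events"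
  proof -
    have "{u \<in> space stick_measure. \<not> (d \<le> stick_breaking u 0 \<and>
            (\<forall>k\<le>2 * m. d / (real (2 * m) + 1) ^ 5 \<le> stick_breaking u k))} \<in> sticks.events"
      by measurable
    then show ?thesis by (simp add: bad_def space_PiM)
  qed
  have "real m * d / 8 * (1 / 2) \<le> real m * d / 8 * (1 - sticks.prob bad)"
    using sticks d unfolding bad_def[symmetric] by (intro mult_left_mono) simp_all
  also have "\<dots> \<le> (\<integral>u. (\<integral>\<xi>. ?J (random_measure \<nu> u \<xi>) \<partial>labels) \<partial>stick_measure)"
  proof (rule sticks.P.expectation_ge_off_event[OF J_law(2) _ bad_meas])
    show "0 \<le> (\<integral>\<xi>. ?J (random_measure \<nu> u \<xi>) \<partial>labels)" for u
      by (intro Bochner_Integration.integral_nonneg J_nonneg(1) random_measure_in_space)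
    show "AE u in stick_measure. u \<notin> bad \<longrightarrow> real m * d / 8 \<le> (\<integral>\<xi>. ?J (random_measure \<nu> u \<xi>) \<partial>labels)"
      using AE_sticks_unit AE_sticks_sums
    proof eventually_elim
      case (elim u)
      show ?case
      proof
        assume "u \<notin> bad"
        then have u: "d \<le> stick_breaking u 0" "\<And>k. k \<le> 2 * m \<Longrightarrow> d / (real (2 * m) + 1) ^ 5 \<le> stick_breaking u k"
          by (auto simp: bad_def)
        have "1 / real M \<le> d / (real (2 * m) + 1) ^ 5"
          using r d by (simp add: M_def field_simps)
        then show "real m * d / 8 \<le> (\<integral>\<xi>. ?J (random_measure \<nu> u \<xi>) \<partial>labels)"
          using elim d u(1) order_trans[OF _ u(2)]
          by (intro energy_density_given_sticks) (auto simp: valid_sticks_def M_def)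
      qed
    qed
  qed (use d in simp)
  also have "\<dots> = (\<integral>\<mu>. ?J \<mu> \<partial>law)" by (simp only: J_law(3))
  also have "\<dots> \<le> (\<integral>\<mu>. ?J \<mu> + ?J' \<mu> \<partial>law)"
    using J_law(1) J'_law J_nonneg by (intro integral_mono) (auto simp: space_law)
  also have "\<dots> = (\<integral>\<mu>. cov_form \<mu> (gradient half_cylinder \<mu>) (gradient (test_cylinder (log_poly M)) \<mu>) \<partial>law)"
    by (intro Bochner_Integration.integral_cong refl, subst cov_form_half_test_cylinder)
       (auto simp: space_law space_prob_algebra log_poly_derivative)
  finally show ?thesis by (simp add: energy_def M_def mult_ac)
qed

end

section \<open>Non-existence of the generator at \<open>H\<close>\<close>
lemma quadratic_eventually_less_exponential:
  fixes a b e :: real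
  assumes "e > 0"
  obtains j :: nat where "(a + b * real j)\<^sup>2 < e * 2 ^ j"
proof -
  define x where "x = sqrt (1 / 2)"
  have x: "0 < x" "x < 1" "x\<^sup>2 = 1 / 2" by (auto simp: x_def)
  have "(\<lambda>j. (a * x ^ j + b * (real j * x ^ j))\<^sup>2) \<longlonglongrightarrow> (a * 0 + b * 0)\<^sup>2"
    using x by (intro tendsto_intros LIMSEQ_power_zero powser_times_n_limit_0) auto
  then have "eventually (\<lambda>j. (a * x ^ j + b * (real j * x ^ j))\<^sup>2 < e) sequentially"
    using assms by (intro order_tendstoD) auto
  then obtain j where "(a * x ^ j + b * (real j * x ^ j))\<^sup>2 < e"
    by (auto simp: eventually_sequentially)
  moreover have "(a * x ^ j + b * (real j * x ^ j))\<^sup>2 = (a + b * real j)\<^sup>2 * (x\<^sup>2) ^ j"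
    by (simp add: power2_eq_square power_mult_distrib algebra_simps)
  ultimately show thesis
    by (intro that[of j]) (simp add: x(3) power_one_over field_simps)
qed

theorem proposition3p1:
  fixes \<alpha> \<theta> :: real
    and \<nu>0 :: "'a::metric_space measure"
    and B :: "nat \<Rightarrow> nat \<Rightarrow> 'a set"
    and H :: "'a cylinder"
  assumes "\<alpha> = 1 / 2" and "\<theta> = 0"
    and "locally_compact_space (euclidean :: 'a topology)"
    and "separable_space (euclidean :: 'a topology)"
    and "prob_space \<nu>0" and "sets \<nu>0 = sets borel"
    and diffuse: "\<And>x. measure \<nu>0 {x} = 0"
    and "\<And>k j. 1 \<le> k \<Longrightarrow> j \<in> {1..2 ^ k} \<Longrightarrow> B k j \<in> sets borel"
    and "\<And>k. 1 \<le> k \<Longrightarrow> disjoint_family_on (B k) {1..2 ^ k}"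
    and "\<And>k. 1 \<le> k \<Longrightarrow> (\<Union>j\<in>{1..2 ^ k}. B k j) = UNIV"
    and "\<And>k j. 1 \<le> k \<Longrightarrow> j \<in> {1..2 ^ k} \<Longrightarrow> measure \<nu>0 (B k j) = 1 / 2 ^ k"
    and "\<And>k j. 1 \<le> k \<Longrightarrow> j \<in> {1..2 ^ k} \<Longrightarrow> B k j = B (Suc k) (2 * j - 1) \<union> B (Suc k) (2 * j)"
    and H: "H = Cylinder 1 (\<lambda>y. y 0) (\<lambda>_. indicator (B 1 1))"
  shows "\<not> (\<exists>LH. square_integrable (dirichlet_process \<alpha> \<theta> \<nu>0) LH \<and>
           (\<forall>G\<in>cylinders. energy (dirichlet_process \<alpha> \<theta> \<nu>0) H G =
              (\<integral>\<mu>. - LH \<mu> * cyl_fun G \<mu> \<partial>dirichlet_process \<alpha> \<theta> \<nu>0)))"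
proof
  let ?Q = "dirichlet_process (1 / 2) 0 \<nu>0"
  assume "\<exists>LH. square_integrable (dirichlet_process \<alpha> \<theta> \<nu>0) LH \<and>
           (\<forall>G\<in>cylinders. energy (dirichlet_process \<alpha> \<theta> \<nu>0) H G =
              (\<integral>\<mu>. - LH \<mu> * cyl_fun G \<mu> \<partial>dirichlet_process \<alpha> \<theta> \<nu>0))"
  then obtain LH where LH: "square_integrable ?Q LH"
    and rep: "\<And>G. G \<in> cylinders \<Longrightarrow> energy ?Q H G = (\<integral>\<mu>. - LH \<mu> * cyl_fun G \<mu> \<partial>?Q)"
    unfolding \<open>\<alpha> = 1 / 2\<close> \<open>\<theta> = 0\<close> by blast
  have union: "(\<Union>i<2 ^ j. B (Suc j) (Suc i)) = B 1 1" for j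
  proof (induction j)
    case (Suc j)
    have "(\<Union>i<2 ^ Suc j. B (Suc (Suc j)) (Suc i)) = (\<Union>i<2 ^ j. B (Suc (Suc j)) (Suc (2 * i)) \<union> B (Suc (Suc j)) (Suc (2 * i + 1)))"
    proof (intro equalityI subsetI)
      fix x assume "x \<in> (\<Union>i<2 ^ Suc j. B (Suc (Suc j)) (Suc i))"
      then obtain i where i: "i < 2 ^ Suc j" "x \<in> B (Suc (Suc j)) (Suc i)" by auto
      have "i div 2 < 2 ^ j" using i by simp
      moreover have "i = 2 * (i div 2) \<or> i = 2 * (i div 2) + 1" by linarith
      ultimately show "x \<in> (\<Union>i<2 ^ j. B (Suc (Suc j)) (Suc (2 * i)) \<union> B (Suc (Suc j)) (Suc (2 * i + 1)))"
        using i by (intro UN_I[of "i div 2"]) auto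
    qed force
    also have "\<dots> = (\<Union>i<2 ^ j. B (Suc j) (Suc i))"
      using assms(12)[of "Suc j"] by (intro SUP_cong refl) auto
    finally show ?case using Suc by simp
  qed (auto simp: lessThan_Suc)
  have partition: "halved_partition \<nu>0 (\<lambda>i. B (Suc j) (Suc i)) (2 ^ j) (B 1 1)" for j
  proof -
    have cell_index: "Suc i \<in> {1..2 ^ Suc j}" if "i < 2 * 2 ^ j" for i using that by auto
    have index_image: "Suc ` {..<2 * 2 ^ j} = {1..2 ^ Suc j}"
      by (auto simp: image_Suc_lessThan)
    have "disjoint_family_on (\<lambda>i. B (Suc j) (Suc i)) {..<2 * 2 ^ j}"
    proof (unfold disjoint_family_on_def, intro ballI impI)
      fix i i' :: nat assume "i \<in> {..<2 * 2 ^ j}" "i' \<in> {..<2 * 2 ^ j}" "i \<noteq> i'"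
      then show "B (Suc j) (Suc i) \<inter> B (Suc j) (Suc i') = {}"
        by (intro disjoint_family_onD[OF assms(9)] cell_index) auto
    qed
    moreover have "(\<Union>i<2 * 2 ^ j. B (Suc j) (Suc i)) = UNIV"
    proof -
      have "(\<Union>i<2 * 2 ^ j. B (Suc j) (Suc i)) = (\<Union>i\<in>Suc ` {..<2 * 2 ^ j}. B (Suc j) i)"
        by (simp only: image_image)
      also have "\<dots> = UNIV" unfolding index_image by (rule assms(10)) simp
      finally show ?thesis .
    qed
    ultimately show ?thesis
      using assms(5,6) assms(8)[OF _ cell_index] assms(11)[OF _ cell_index] union[of j]
      by (intro halved_partition.intro halved_partition_axioms.intro) simp_all
  qed
  obtain d where d: "d > 0" and sticks:
    "\<And>n. measure stick_measure {u. \<not> (d \<le> stick_breaking u 0 \<and>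
            (\<forall>k\<le>n. d / (real n + 1) ^ 5 \<le> stick_breaking u k))} \<le> 1 / 2"
    using stick_breaking_polynomial_lower_bound by blast
  obtain r0 where r0: "1 / d < 2 ^ r0" using real_arch_pow[of 2 "1 / d"] by auto
  \<comment> \<open>The summand 1 makes it harmless to divide by \<open>N\<close>.\<close>
  define N where "N = (\<integral>\<mu>. (LH \<mu>)\<^sup>2 \<partial>?Q) + 1"
  have N: "N \<ge> 1" by (simp add: N_def)
  define s where "s = d / 32"
  have s: "s > 0" using d by (simp add: s_def)
  have bound: "s\<^sup>2 * 2 ^ j \<le> N * (1 + real (r0 + 5 * (j + 2)))\<^sup>2" for j
  proof -
    interpret halved_partition \<nu>0 "\<lambda>i. B (Suc j) (Suc i)" "2 ^ j" "B 1 1" by (rule partition)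
    define r where "r = r0 + 5 * (j + 2)"
    let ?G = "test_cylinder (log_poly (2 ^ r))"
    have "1 \<le> (2 :: real) ^ j" "real (2 * 2 ^ j) = 2 * 2 ^ j" "(2 :: real) ^ (j + 2) = 4 * 2 ^ j"
      by (simp_all add: power_add)
    then have "real (2 * 2 ^ j) + 1 \<le> 2 ^ (j + 2)" by linarith
    then have "(real (2 * 2 ^ j) + 1) ^ 5 \<le> (2 ^ (j + 2)) ^ 5"
      by (intro power_mono) auto
    then have "(real (2 * 2 ^ j) + 1) ^ 5 / d \<le> (2 ^ (j + 2)) ^ 5 * 2 ^ r0"
      using r0 d mult_mono[of "(real (2 * 2 ^ j) + 1) ^ 5" "(2 ^ (j + 2)) ^ 5" "1 / d" "2 ^ r0"] by simp
    also have "\<dots> = 2 ^ r" unfolding r_def power_add[of 2 r0] mult.commute[of 5] power_mult by (rule mult.commute)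
    finally have r: "(real (2 * 2 ^ j) + 1) ^ 5 / d \<le> 2 ^ r" .
    \<comment> \<open>With this weight the term that contains \<open>LH\<close> uses up only half of the energy.\<close>
    define t where "t = s * 2 ^ j / N"
    have t: "t > 0" using s N by (simp add: t_def)
    have "s * 2 ^ j \<le> energy ?Q H ?G"
      using energy_test_cylinder[OF d sticks r] by (simp add: H s_def mult_ac)
    also have "\<dots> = (\<integral>\<mu>. - LH \<mu> * cyl_fun ?G \<mu> \<partial>?Q)"
      by (rule rep[OF test_cylinder_in_cylinders])
    also have "\<dots> \<le> (t * (\<integral>\<mu>. (- LH \<mu>)\<^sup>2 \<partial>?Q) + (\<integral>\<mu>. (cyl_fun ?G \<mu>)\<^sup>2 \<partial>?Q) / t) / 2"
      using LH t by (intro integral_mult_le_square_integrable second_moment_test_cylinder)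
        (auto simp: square_integrable_def)
    also have "\<dots> \<le> (t * N + 2 ^ j * (1 + real r)\<^sup>2 / t) / 2"
      using second_moment_test_cylinder(2)[of r] t
      by (intro divide_right_mono add_mono mult_left_mono) (auto simp: N_def)
    also have "\<dots> = (s * 2 ^ j + N * (1 + real r)\<^sup>2 / s) / 2"
      using N s by (simp add: t_def field_simps)
    finally have "s * 2 ^ j \<le> N * (1 + real r)\<^sup>2 / s" by simp
    then show ?thesis using s by (simp add: r_def power2_eq_square field_simps)
  qed
  obtain j where "(real (r0 + 11) + 5 * real j)\<^sup>2 < s\<^sup>2 / N * 2 ^ j"
    by (rule quadratic_eventually_less_exponential[of "s\<^sup>2 / N"]) (use s N in auto)
  then have "N * (real (r0 + 11) + 5 * real j)\<^sup>2 < s\<^sup>2 * 2 ^ j" using N by (simp add: field_simps)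
  moreover have "1 + real (r0 + 5 * (j + 2)) = real (r0 + 11) + 5 * real j" by simp
  ultimately show False using bound[of j] by (simp only:)
qed

end
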